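(* Let $k$ be a differential field of characteristic zero, let $\overline{k}$ be an algebraic closure of $k$ (with the unique derivation extending that of $k$), and let $E$ be a liouvillian extension of $\overline{k}$ with $C_E=C_{\overline{k}}$. Let $n\ge 3$, let $\alpha_1,\alpha_2,\dots,\alpha_n\in k$, and let $$F(Y,Y')=Y'-\alpha_nY^n-\cdots-\alpha_2Y^2-\alpha_1Y.$$ Suppose that there is an element $y\in E$, $y\notin\overline{k}$, such that $F(y,y')=0$. I. If there is a nonzero element $\gamma\in\overline{k}$ such that $\gamma'=\alpha_1\gamma$, then there is no $z\in\overline{k}(y)-\overline{k}$ such that $z'/z\in\overline{k}$. II. If $\alpha_1=0$ and $x'\neq\alpha_2$ for all $x\in k$, then there is an element $w\in\overline{k}(y)-\overline{k}$ and an element $v\in\overline{k}$ such that $w'=\alpha_2$ and $v'=\alpha_3$.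
   Context: A differential field is a field with a derivation $'$; $C_F=\{x\in F: x'=0\}$ is the field of constants of a differential field $F$. $A-B$ denotes set difference. A differential field extension $E$ of a differential field $k_0$ is a liouvillian extension of $k_0$ if $E=k_0(t_1,\dots,t_m)$ and there is a tower of differential fields $k_0\subset k_1\subset\cdots\subset k_m=E$ such that for each $i\geq 1$, $k_i=k_{i-1}(t_i)$ and either $t_i'\in k_{i-1}$, or $t_i'/t_i\in k_{i-1}$ (with $t_i\neq 0$), or $t_i$ is algebraic over $k_{i-1}$. Here this is applied with base field $k_0=\overline{k}$. *)

theory Defs
  imports Complex_Main "HOL-Computational_Algebra.Polynomial"
begin

text \<open>
  All fields are subsets of one ambient field, given by a type of class \<open>field\<close>; an inclusion of
  fields is set inclusion. A single derivation \<open>D\<close> of the ambient field is fixed, and differential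
  subfields are the subfields closed under \<open>D\<close>, equipped with the restriction of \<open>D\<close>.
\<close>

definition derivation :: "('a::field \<Rightarrow> 'a) \<Rightarrow> bool" where
  "derivation D \<longleftrightarrow>
     (\<forall>x y. D (x + y) = D x + D y) \<and> (\<forall>x y. D (x * y) = D x * y + x * D y)"

definition subfield :: "'a::field set \<Rightarrow> bool" where
  "subfield K \<longleftrightarrow>
     0 \<in> K \<and> 1 \<in> K \<and>
     (\<forall>x\<in>K. \<forall>y\<in>K. x + y \<in> K \<and> x * y \<in> K) \<and>
     (\<forall>x\<in>K. - x \<in> K \<and> inverse x \<in> K)"

definition differential_subfield :: "('a::field \<Rightarrow> 'a) \<Rightarrow> 'a set \<Rightarrow> bool" where
  "differential_subfield D K \<longleftrightarrow> subfield K \<and> (\<forall>x\<in>K. D x \<in> K)"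

definition constants :: "('a::field \<Rightarrow> 'a) \<Rightarrow> 'a set \<Rightarrow> 'a set" where
  "constants D K = {x \<in> K. D x = 0}"

text \<open>\<open>adjoin K S\<close> is the field \<open>K(S)\<close>: closure under the field operations only, not under \<open>D\<close>.\<close>

definition adjoin :: "'a::field set \<Rightarrow> 'a set \<Rightarrow> 'a set" where
  "adjoin K S = subfield hull (K \<union> S)"

definition algebraic_over :: "'a::field set \<Rightarrow> 'a \<Rightarrow> bool" where
  "algebraic_over K x \<longleftrightarrow> (\<exists>p. p \<noteq> 0 \<and> set (coeffs p) \<subseteq> K \<and> poly p x = 0)"

definition is_algebraic_closure :: "'a::field set \<Rightarrow> 'a set \<Rightarrow> bool" where
  "is_algebraic_closure K L \<longleftrightarrow>
     subfield K \<and> subfield L \<and> K \<subseteq> L \<and>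
     (\<forall>x\<in>L. algebraic_over K x) \<and>
     (\<forall>p. set (coeffs p) \<subseteq> L \<and> degree p > 0 \<longrightarrow> (\<exists>x\<in>L. poly p x = 0))"

text \<open>
  In the tower below, \<open>k i\<close> and \<open>t i\<close> are the field and the generator with index \<open>i\<close>; the values
  \<open>t 0\<close>, and \<open>k i\<close> and \<open>t i\<close> for \<open>i > m\<close>, play no role.
\<close>

definition liouvillian_extension :: "('a::field \<Rightarrow> 'a) \<Rightarrow> 'a set \<Rightarrow> 'a set \<Rightarrow> bool" where
  "liouvillian_extension D K E \<longleftrightarrow>
     (\<exists>(m::nat) (t :: nat \<Rightarrow> 'a) (k :: nat \<Rightarrow> 'a set).
        E = adjoin K (t ` {1..m}) \<and>
        k 0 = K \<and> k m = E \<and>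
        (\<forall>i\<le>m. differential_subfield D (k i)) \<and>
        (\<forall>i\<in>{1..m}.
           k i = adjoin (k (i - 1)) {t i} \<and>
           (D (t i) \<in> k (i - 1) \<or>
            (t i \<noteq> 0 \<and> D (t i) / t i \<in> k (i - 1)) \<or>
            algebraic_over (k (i - 1)) (t i))))"

end

theory Submission
  imports Defs "HOL-Computational_Algebra.Formal_Laurent_Series"
begin

text \<open>
  Write \<open>L\<close> for the algebraically closed base field. After dividing \<open>y\<close> by the solution \<open>\<gamma>\<close> of
  the linear part, the equation reads \<open>D y = P(y)\<close> with \<open>P\<close> divisible by \<open>Y\<^sup>2\<close>. Then the
  derivation of \<open>L(y)\<close> extends to the Laurent series in \<open>y\<close>, and it does not lower the order of a
  series; the leading coefficient \<open>c\<close> of a series \<open>g\<close> with \<open>D g = a g + b\<close> obeys \<open>D c = a c\<close>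
  unless its index is \<open>0\<close>. Dividing by that coefficient produces an element whose
  expansion has leading coefficient \<open>1\<close>, and it must have a pole at \<open>y = 0\<close>, because otherwise a
  new constant would appear (\<open>linear_element_normal_form\<close>). For \<open>b = 0\<close> the quotient is itself a
  constant, so no such \<open>g\<close> exists outside \<open>L\<close>. This is the first part.

  The second part needs some \<open>g\<close> in \<open>L(y)\<close> outside \<open>L\<close> with \<open>D g = a g + b\<close> and \<open>a\<close>, \<open>b\<close> in \<open>L\<close>
  (\<open>linear_element_exists\<close>). Start at the step \<open>k(t)\<close> of the tower over which \<open>y\<close> becomes algebraic.
  There \<open>t\<close> is algebraic over \<open>k(y)\<close>, and the trace of \<open>t\<close>, or of a power of \<open>t\<close>, is such an element
  over \<open>k\<close>. It is then carried down the tower. Through a transcendental step it passes to a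
  coefficient of its Laurent series in the generator, which is a rational function of \<open>y\<close> over
  the smaller field. Through an algebraic step it passes by the trace, which commutes with the
  derivation and keeps the leading coefficient \<open>1\<close> at \<open>y = 0\<close>, hence the pole.

  Over \<open>L\<close>, normalise \<open>g\<close> so that \<open>D g = b\<close> and \<open>g = y^m + f y^(m+1) + \<dots>\<close> with \<open>m < 0\<close>.
  Comparing coefficients at the index \<open>m + 1\<close> makes \<open>- f / m\<close> a primitive of \<open>\<alpha>\<^sub>2\<close> unless
  \<open>m = - 1\<close>. By a trace argument such a primitive in \<open>L\<close> would yield one in the field \<open>K\<close>. So
  \<open>m = - 1\<close>, and the comparison gives \<open>D (f - g) = \<alpha>\<^sub>2\<close>; the coefficients at the index \<open>1\<close> give
  a primitive of \<open>\<alpha>\<^sub>3\<close>.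
\<close>

unbundle fps_syntax

section \<open>Subfields, and polynomials over a subfield\<close>

lemma subfield_0: "subfield K \<Longrightarrow> 0 \<in> K"
  and subfield_1: "subfield K \<Longrightarrow> 1 \<in> K"
  and subfield_add: "subfield K \<Longrightarrow> x \<in> K \<Longrightarrow> y \<in> K \<Longrightarrow> x + y \<in> K"
  and subfield_mult: "subfield K \<Longrightarrow> x \<in> K \<Longrightarrow> y \<in> K \<Longrightarrow> x * y \<in> K"
  and subfield_uminus: "subfield K \<Longrightarrow> x \<in> K \<Longrightarrow> - x \<in> K"
  and subfield_inverse: "subfield K \<Longrightarrow> x \<in> K \<Longrightarrow> inverse x \<in> K"
  unfolding subfield_def by auto

lemma subfield_diff: "subfield K \<Longrightarrow> x \<in> K \<Longrightarrow> y \<in> K \<Longrightarrow> x - y \<in> K"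
  using subfield_add[of K x "- y"] subfield_uminus by auto

lemma subfield_divide: "subfield K \<Longrightarrow> x \<in> K \<Longrightarrow> y \<in> K \<Longrightarrow> x / y \<in> K"
  by (simp add: divide_inverse subfield_mult subfield_inverse)

lemma subfield_power: "subfield K \<Longrightarrow> x \<in> K \<Longrightarrow> x ^ n \<in> K"
  by (induction n) (auto simp: subfield_1 subfield_mult)

lemma subfield_of_nat: "subfield K \<Longrightarrow> of_nat n \<in> K"
  by (induction n) (auto simp: subfield_0 subfield_1 subfield_add)

lemma subfield_of_int: "subfield K \<Longrightarrow> of_int n \<in> K"
  by (cases n) (auto simp: subfield_of_nat subfield_diff subfield_uminus subfield_1 subfield_add)

lemma subfield_sum: "subfield K \<Longrightarrow> (\<And>i. i \<in> I \<Longrightarrow> f i \<in> K) \<Longrightarrow> sum f I \<in> K"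
  by (induction I rule: infinite_finite_induct) (auto simp: subfield_0 subfield_add)

lemmas subfield_intros = subfield_0 subfield_1 subfield_add subfield_mult subfield_uminus
  subfield_inverse subfield_diff subfield_divide subfield_power subfield_of_nat subfield_of_int
  subfield_sum

definition polys_over :: "'a::zero set \<Rightarrow> 'a poly set" where
  "polys_over K = {p. \<forall>i. coeff p i \<in> K}"

lemma polys_overI: "(\<And>i. coeff p i \<in> K) \<Longrightarrow> p \<in> polys_over K"
  and polys_overD: "p \<in> polys_over K \<Longrightarrow> coeff p i \<in> K"
  by (auto simp: polys_over_def)

lemma polys_over_mono: "K \<subseteq> L \<Longrightarrow> polys_over K \<subseteq> polys_over L"
  by (auto simp: polys_over_def)

context
  fixes K :: "'a::field set"
  assumes K: "subfield K"
begin

lemma set_coeffs_subset_iff: "set (coeffs p) \<subseteq> K \<longleftrightarrow> p \<in> polys_over K"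
proof -
  have "set (coeffs p) \<subseteq> K \<longleftrightarrow> range (coeff p) \<subseteq> K"
    using subfield_0[OF K] by (simp add: range_coeff)
  then show ?thesis unfolding polys_over_def by auto
qed

lemma algebraic_over_iff: "algebraic_over K x \<longleftrightarrow> (\<exists>p\<in>polys_over K. p \<noteq> 0 \<and> poly p x = 0)"
  unfolding algebraic_over_def set_coeffs_subset_iff by auto

lemma polys_over_0: "0 \<in> polys_over K"
  and polys_over_1: "1 \<in> polys_over K"
  and polys_over_add: "p \<in> polys_over K \<Longrightarrow> q \<in> polys_over K \<Longrightarrow> p + q \<in> polys_over K"
  and polys_over_diff: "p \<in> polys_over K \<Longrightarrow> q \<in> polys_over K \<Longrightarrow> p - q \<in> polys_over K"
  and polys_over_uminus: "p \<in> polys_over K \<Longrightarrow> - p \<in> polys_over K"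
  and polys_over_smult: "c \<in> K \<Longrightarrow> p \<in> polys_over K \<Longrightarrow> smult c p \<in> polys_over K"
  and polys_over_mult: "p \<in> polys_over K \<Longrightarrow> q \<in> polys_over K \<Longrightarrow> p * q \<in> polys_over K"
  and polys_over_monom: "c \<in> K \<Longrightarrow> monom c n \<in> polys_over K"
  and polys_over_pCons: "c \<in> K \<Longrightarrow> p \<in> polys_over K \<Longrightarrow> pCons c p \<in> polys_over K"
  and polys_over_pderiv: "p \<in> polys_over K \<Longrightarrow> pderiv p \<in> polys_over K"
  using K by (auto simp: polys_over_def coeff_mult coeff_pCons coeff_pderiv
      intro!: subfield_intros split: nat.splits simp del: of_nat_Suc)

lemma polys_over_sum: "(\<And>i. i \<in> I \<Longrightarrow> f i \<in> polys_over K) \<Longrightarrow> sum f I \<in> polys_over K"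
  by (induction I rule: infinite_finite_induct) (auto simp: polys_over_0 polys_over_add)

lemmas polys_over_intros = polys_over_0 polys_over_1 polys_over_add polys_over_diff
  polys_over_uminus polys_over_smult polys_over_mult polys_over_monom polys_over_pCons
  polys_over_pderiv polys_over_sum

lemma poly_in_subfield: "p \<in> polys_over K \<Longrightarrow> x \<in> K \<Longrightarrow> poly p x \<in> K"
  unfolding poly_altdef by (intro subfield_intros[OF K]) (auto dest: polys_overD)

lemma polys_over_division:
  assumes "p \<in> polys_over K" "p \<noteq> 0" "q \<in> polys_over K"
  obtains h r where "h \<in> polys_over K" "r \<in> polys_over K" "q = p * h + r"
    "r = 0 \<or> degree r < degree p"
proof -
  have "\<exists>h\<in>polys_over K. \<exists>r\<in>polys_over K. q = p * h + r \<and> (r = 0 \<or> degree r < degree p)"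
    using assms(3)
  proof (induction "degree q" arbitrary: q rule: less_induct)
    case less
    show ?case
    proof (cases "q = 0 \<or> degree q < degree p")
      case True
      then show ?thesis
        using less.prems by (intro bexI[of _ 0] bexI[of _ q]) (auto intro: polys_over_intros)
    next
      case False
      define c where "c = monom (lead_coeff q / lead_coeff p) (degree q - degree p)"
      have c: "c \<in> polys_over K"
        unfolding c_def using assms(1) less.prems
        by (intro polys_over_intros subfield_intros[OF K]) (auto dest: polys_overD)
      define q' where "q' = q - p * c"
      have q': "q' \<in> polys_over K"
        unfolding q'_def using assms(1) less.prems c by (intro polys_over_intros)
      have nz: "lead_coeff q / lead_coeff p \<noteq> 0"
        using False assms(2) by auto
      have deg1: "degree (p * c) = degree q"
        using False assms(2) nz by (auto simp: c_def degree_mult_eq degree_monom_eq)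
      have "lead_coeff (p * c) = lead_coeff p * lead_coeff c"
        by (rule lead_coeff_mult)
      also have "\<dots> = lead_coeff q"
        using assms(2) nz by (simp add: c_def degree_monom_eq)
      finally have deg: "degree (p * c) = degree q" "coeff (p * c) (degree q) = lead_coeff q"
        using deg1 by simp_all
      have "degree q' < degree q \<or> q' = 0"
      proof (cases "degree q = 0")
        case True
        have "q' = 0"
        proof (rule poly_eqI)
          fix n show "coeff q' n = coeff 0 n"
            unfolding q'_def using True deg by (cases n) (auto simp: coeff_eq_0)
        qed
        then show ?thesis ..
      next
        case False
        have "degree q' \<le> degree q" "coeff q' (degree q) = 0"
          unfolding q'_def using deg by (auto intro: degree_diff_le)
        then show ?thesis
          by (metis le_neq_implies_less leading_coeff_0_iff)
      qed
      then consider "q' = 0" | "degree q' < degree q" by blast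
      then obtain h r where "h \<in> polys_over K" "r \<in> polys_over K" "q' = p * h + r"
        "r = 0 \<or> degree r < degree p"
        using less.hyps q' polys_over_0 by cases (fastforce, blast)
      moreover from this have "q = p * (h + c) + r"
        unfolding q'_def by (simp add: algebra_simps)
      ultimately show ?thesis
        using c polys_over_add by blast
    qed
  qed
  then show thesis using that by blast
qed

end

section \<open>Simple extensions\<close>

lemma subfield_adjoin: "subfield (adjoin K S)"
  unfolding adjoin_def by (rule hull_in) (auto simp: subfield_def)

lemma subset_adjoin: "K \<subseteq> adjoin K S" and generators_in_adjoin: "S \<subseteq> adjoin K S"
  unfolding adjoin_def using hull_subset[of "K \<union> S" subfield] by auto

lemma generator_in_adjoin: "s \<in> adjoin K {s}"
  using generators_in_adjoin[of "{s}"] by auto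

lemma adjoin_least: "subfield L \<Longrightarrow> K \<subseteq> L \<Longrightarrow> S \<subseteq> L \<Longrightarrow> adjoin K S \<subseteq> L"
  unfolding adjoin_def by (rule hull_minimal) auto

lemma adjoin_mono: "K \<subseteq> L \<Longrightarrow> adjoin K S \<subseteq> adjoin L S"
  using adjoin_least[OF subfield_adjoin] subset_adjoin generators_in_adjoin by (metis order_trans)

lemma poly_in_adjoin: "p \<in> polys_over K \<Longrightarrow> poly p s \<in> adjoin K {s}"
  using poly_in_subfield[OF subfield_adjoin _ generator_in_adjoin]
    polys_over_mono[OF subset_adjoin] by blast

lemma adjoin_iff_fraction:
  assumes K: "subfield K"
  shows "x \<in> adjoin K {s} \<longleftrightarrow> (\<exists>A\<in>polys_over K. \<exists>B\<in>polys_over K. x = poly A s / poly B s)"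
proof -
  define R where "R = {x. \<exists>A\<in>polys_over K. \<exists>B\<in>polys_over K. x = poly A s / poly B s}"
  have RI: "x \<in> R" if "A \<in> polys_over K" "B \<in> polys_over K" "x = poly A s / poly B s" for x A B
    using that unfolding R_def by blast
  have RE: thesis if "x \<in> R"
    "\<And>A B. A \<in> polys_over K \<Longrightarrow> B \<in> polys_over K \<Longrightarrow> x = poly A s / poly B s \<Longrightarrow> thesis" for x thesis
    using that unfolding R_def by blast
  have const: "c \<in> R" if "c \<in> K" for c
    by (rule RI[of "[:c:]" 1]) (use that K in \<open>auto intro: polys_over_intros\<close>)
  have neg: "- x \<in> R" if "x \<in> R" for x
    using that
  proof (rule RE)
    fix A B assume "A \<in> polys_over K" "B \<in> polys_over K" "x = poly A s / poly B s"
    then show ?thesis by (intro RI[of "- A" B]) (auto intro: polys_over_uminus[OF K])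
  qed
  have inv: "inverse x \<in> R" if "x \<in> R" for x
    using that
  proof (rule RE)
    fix A B assume "A \<in> polys_over K" "B \<in> polys_over K" "x = poly A s / poly B s"
    then show ?thesis by (intro RI[of B A]) auto
  qed
  have mult: "x * y \<in> R" and add: "x + y \<in> R" if xy: "x \<in> R" "y \<in> R" for x y
  proof -
    obtain A B where AB: "A \<in> polys_over K" "B \<in> polys_over K" "x = poly A s / poly B s"
      using xy(1) by (rule RE)
    obtain A' B' where AB': "A' \<in> polys_over K" "B' \<in> polys_over K" "y = poly A' s / poly B' s"
      using xy(2) by (rule RE)
    show "x * y \<in> R"
      using AB AB' by (intro RI[of "A * A'" "B * B'"]) (auto intro: polys_over_mult[OF K])
    consider "x + y = x" | "x + y = y" | "poly B s \<noteq> 0" "poly B' s \<noteq> 0"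
      using AB(3) AB'(3) by force
    then show "x + y \<in> R"
    proof cases
      case 3
      then have "x + y = poly (A * B' + A' * B) s / poly (B * B') s"
        unfolding AB(3) AB'(3) by (simp add: field_simps)
      then show ?thesis
        by (rule RI[rotated 2])
          (use AB AB' in \<open>auto intro!: polys_over_mult[OF K] polys_over_add[OF K]\<close>)
    qed (use xy in simp_all)
  qed
  have "s \<in> R"
    by (rule RI[of "[:0, 1:]" 1]) (use K in \<open>auto intro!: polys_over_intros subfield_intros\<close>)
  moreover have "subfield R"
    unfolding subfield_def
    by (intro conjI ballI const[OF subfield_0[OF K]] const[OF subfield_1[OF K]] neg inv mult add)
  ultimately have "adjoin K {s} \<subseteq> R"
    using const by (intro adjoin_least) auto
  moreover have "x \<in> adjoin K {s}" if "x \<in> R" for x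
    using that by (rule RE) (auto intro: subfield_divide[OF subfield_adjoin] poly_in_adjoin)
  ultimately show ?thesis unfolding R_def by blast
qed

lemma algebraic_over_mono: "K \<subseteq> L \<Longrightarrow> algebraic_over K x \<Longrightarrow> algebraic_over L x"
  unfolding algebraic_over_def by blast

lemma algebraic_over_element: "subfield K \<Longrightarrow> x \<in> K \<Longrightarrow> algebraic_over K x"
  unfolding algebraic_over_iff
  by (rule bexI[of _ "[:-x, 1:]"]) (auto intro!: polys_over_intros subfield_intros)

lemma transcendental_poly_eq_0:
  "subfield K \<Longrightarrow> \<not> algebraic_over K x \<Longrightarrow> p \<in> polys_over K \<Longrightarrow> poly p x = 0 \<longleftrightarrow> p = 0"
  using algebraic_over_iff[of K x] by auto

definition is_min_poly :: "'a::field set \<Rightarrow> 'a \<Rightarrow> 'a poly \<Rightarrow> bool" where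
  "is_min_poly K s q \<longleftrightarrow> q \<in> polys_over K \<and> lead_coeff q = 1 \<and> poly q s = 0 \<and>
     (\<forall>p\<in>polys_over K. poly p s = 0 \<and> degree p < degree q \<longrightarrow> p = 0)"

lemma min_poly_exists:
  assumes K: "subfield K" and alg: "algebraic_over K s"
  obtains q where "is_min_poly K s q"
proof -
  let ?P = "\<lambda>p. p \<in> polys_over K \<and> p \<noteq> 0 \<and> poly p s = 0"
  define p where "p = arg_min degree ?P"
  obtain p0 where "?P p0" using alg unfolding algebraic_over_iff[OF K] by blast
  then have p: "?P p" and min: "?P r \<Longrightarrow> degree p \<le> degree r" for r
    unfolding p_def using arg_min_natI[of ?P p0 degree] arg_min_nat_le[of ?P r degree] by blast+
  let ?q = "smult (inverse (lead_coeff p)) p"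
  have "is_min_poly K s ?q"
    unfolding is_min_poly_def
  proof (intro conjI ballI impI)
    show "?q \<in> polys_over K"
      using p K by (auto intro!: polys_over_intros subfield_intros dest: polys_overD)
    fix r assume "r \<in> polys_over K" "poly r s = 0 \<and> degree r < degree ?q"
    then show "r = 0" using min[of r] p by (cases "r = 0") auto
  qed (use p in auto)
  then show thesis by (rule that)
qed

lemma min_poly_degree_pos: "is_min_poly K s q \<Longrightarrow> degree q > 0"
proof (rule ccontr)
  assume q: "is_min_poly K s q" and "\<not> degree q > 0"
  then obtain c where "q = [:c:]" using degree_eq_zeroE by auto
  then show False using q by (auto simp: is_min_poly_def)
qed

lemma poly_mod_min_poly:
  assumes K: "subfield K" and q: "is_min_poly K s q" and p: "p \<in> polys_over K"
  obtains r where "r \<in> polys_over K" "degree r < degree q" "poly r s = poly p s"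
proof -
  have "q \<noteq> 0" using q by (auto simp: is_min_poly_def)
  then obtain h r where "h \<in> polys_over K" "r \<in> polys_over K" "p = q * h + r"
    "r = 0 \<or> degree r < degree q"
    using polys_over_division[OF K _ _ p, of q] q unfolding is_min_poly_def by metis
  then show thesis
    using that[of r] q min_poly_degree_pos[OF q] by (auto simp: is_min_poly_def)
qed

text \<open>
  The Euclidean algorithm against the minimal polynomial: dividing it by \<open>p\<close> leaves a remainder
  whose value at \<open>s\<close> is a multiple of that of \<open>p\<close>, and which has smaller degree.
\<close>

lemma poly_at_algebraic_invertible:
  assumes K: "subfield K" and q: "is_min_poly K s q"
    and p: "p \<in> polys_over K" "poly p s \<noteq> 0" "degree p < degree q"
  shows "\<exists>h\<in>polys_over K. poly h s * poly p s = 1"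
  using p
proof (induction "degree p" arbitrary: p rule: less_induct)
  case less
  show ?case
  proof (cases "degree p = 0")
    case True
    then obtain c where c: "p = [:c:]" using degree_eq_zeroE by auto
    moreover have "c \<in> K" using less.prems(1) c polys_overD[of p K 0] by simp
    ultimately show ?thesis using less.prems K
      by (intro bexI[of _ "[:inverse c:]"]) (auto intro!: polys_over_intros subfield_intros)
  next
    case False
    then have "p \<noteq> 0" by auto
    have q': "q \<in> polys_over K" "poly q s = 0" "q \<noteq> 0"
      using q by (auto simp: is_min_poly_def)
    obtain h r where hr: "h \<in> polys_over K" "r \<in> polys_over K" "q = p * h + r"
      "r = 0 \<or> degree r < degree p"
      using polys_over_division[OF K less.prems(1) \<open>p \<noteq> 0\<close> q'(1)] by metis
    have "r \<noteq> 0"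
    proof
      assume "r = 0"
      then have "poly h s = 0" "h \<noteq> 0" using hr q' less.prems by auto
      moreover have "degree h < degree q"
        using \<open>r = 0\<close> hr(3) \<open>p \<noteq> 0\<close> \<open>h \<noteq> 0\<close> False by (simp add: degree_mult_eq)
      ultimately show False using q hr(1) by (auto simp: is_min_poly_def)
    qed
    then have "degree r < degree p" using hr by auto
    moreover have "poly r s \<noteq> 0"
      using q hr(2) \<open>r \<noteq> 0\<close> calculation less.prems(3) by (auto simp: is_min_poly_def)
    ultimately obtain g where g: "g \<in> polys_over K" "poly g s * poly r s = 1"
      using less.hyps hr(2) less.prems(3) by (meson order.strict_trans)
    have "poly r s = - poly p s * poly h s"
      using hr(3) q'(2) by (metis add.commute add_eq_0_iff mult_minus_left poly_add poly_mult)
    then have "poly (- h * g) s * poly p s = 1"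
      using g(2) by (simp add: algebra_simps)
    then show ?thesis using hr g polys_over_mult[OF K] polys_over_uminus[OF K] by blast
  qed
qed

lemma adjoin_algebraic_iff:
  assumes K: "subfield K" and q: "is_min_poly K s q"
  shows "x \<in> adjoin K {s} \<longleftrightarrow> (\<exists>p\<in>polys_over K. degree p < degree q \<and> x = poly p s)"
proof
  assume "x \<in> adjoin K {s}"
  then obtain A B where AB: "A \<in> polys_over K" "B \<in> polys_over K" "x = poly A s / poly B s"
    using adjoin_iff_fraction[OF K] by blast
  show "\<exists>p\<in>polys_over K. degree p < degree q \<and> x = poly p s"
  proof (cases "poly B s = 0")
    case True
    then show ?thesis using AB polys_over_0[OF K] min_poly_degree_pos[OF q]
      by (intro bexI[of _ 0]) auto
  next
    case False
    obtain B' where "B' \<in> polys_over K" "degree B' < degree q" "poly B' s = poly B s"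
      using poly_mod_min_poly[OF K q AB(2)] by blast
    then obtain h where h: "h \<in> polys_over K" "poly h s * poly B s = 1"
      using poly_at_algebraic_invertible[OF K q, of B'] False by auto
    then have "x = poly (A * h) s"
      using AB(3) nonzero_eq_divide_eq[of "poly B s" "poly h s" 1] False by simp
    then show ?thesis
      using poly_mod_min_poly[OF K q polys_over_mult[OF K AB(1) h(1)]] by metis
  qed
next
  assume "\<exists>p\<in>polys_over K. degree p < degree q \<and> x = poly p s"
  then show "x \<in> adjoin K {s}" using poly_in_adjoin by blast
qed

section \<open>Linear algebra and transitivity of algebraicity\<close>

text \<open>
  Gaussian elimination: solving for one unknown removes one equation and one unknown.
\<close>

lemma homogeneous_system_solvable:
  fixes v :: "'j \<Rightarrow> 'i \<Rightarrow> 'a::field"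
  assumes K: "subfield K" and "finite I" "finite J" "card I < card J"
    and "\<And>j i. j \<in> J \<Longrightarrow> i \<in> I \<Longrightarrow> v j i \<in> K"
  shows "\<exists>c. (\<forall>j\<in>J. c j \<in> K) \<and> (\<exists>j\<in>J. c j \<noteq> 0) \<and> (\<forall>i\<in>I. (\<Sum>j\<in>J. c j * v j i) = 0)"
  using assms(2-)
proof (induction I arbitrary: J v rule: finite_induct)
  case empty
  then show ?case using subfield_1[OF K] by (intro exI[of _ "\<lambda>_. 1"]) (auto simp: card_gt_0_iff)
next
  case (insert i I)
  show ?case
  proof (cases "\<forall>j\<in>J. v j i = 0")
    case True
    have "card I < card J" using insert by auto
    then have "\<exists>c. (\<forall>j\<in>J. c j \<in> K) \<and> (\<exists>j\<in>J. c j \<noteq> 0) \<and> (\<forall>i\<in>I. (\<Sum>j\<in>J. c j * v j i) = 0)"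
      using insert by blast
    then show ?thesis using True by auto
  next
    case False
    then obtain p where p: "p \<in> J" "v p i \<noteq> 0" by blast
    define v' where "v' j k = v j k - v j i / v p i * v p k" for j k
    have "card I < card (J - {p})" using insert p by auto
    moreover have "v' j k \<in> K" if "j \<in> J - {p}" "k \<in> I" for j k
      unfolding v'_def using that insert.prems p by (intro subfield_intros[OF K]) auto
    ultimately obtain c where c: "\<forall>j\<in>J - {p}. c j \<in> K" "\<exists>j\<in>J - {p}. c j \<noteq> 0"
      "\<forall>k\<in>I. (\<Sum>j\<in>J - {p}. c j * v' j k) = 0"
      using insert.IH[of "J - {p}" v'] insert.prems by auto
    define e where "e = - (\<Sum>j\<in>J - {p}. c j * v j i) / v p i"
    have e: "e \<in> K"
      unfolding e_def using c(1) insert.prems p by (intro subfield_intros[OF K]) auto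
    define c' where "c' = c(p := e)"
    have sum: "(\<Sum>j\<in>J. c' j * v j k) = e * v p k + (\<Sum>j\<in>J - {p}. c j * v j k)" for k
      using insert.prems p unfolding c'_def by (subst sum.remove[of _ p]) auto
    have "(\<Sum>j\<in>J. c' j * v j k) = 0" if "k \<in> insert i I" for k
    proof (cases "k = i")
      case True
      then show ?thesis using p unfolding sum e_def by simp
    next
      case False
      then have "0 = (\<Sum>j\<in>J - {p}. c j * v' j k)" using c that by simp
      also have "\<dots> = (\<Sum>j\<in>J - {p}. c j * v j k) - (\<Sum>j\<in>J - {p}. c j * v j i / v p i * v p k)"
        unfolding v'_def by (simp add: algebra_simps sum_subtractf)
      also have "(\<Sum>j\<in>J - {p}. c j * v j i / v p i * v p k) = - e * v p k"
        unfolding e_def by (simp add: sum_divide_distrib sum_distrib_right)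
      finally show ?thesis unfolding sum by (simp add: add.commute)
    qed
    moreover have "\<exists>j\<in>J. c' j \<noteq> 0" using c(2) unfolding c'_def by auto
    moreover have "\<forall>j\<in>J. c' j \<in> K" using c(1) e unfolding c'_def by auto
    ultimately show ?thesis by blast
  qed
qed

definition lin_span :: "'a::field set \<Rightarrow> 'i set \<Rightarrow> ('i \<Rightarrow> 'a) \<Rightarrow> 'a set" where
  "lin_span K I b = {x. \<exists>c. (\<forall>i\<in>I. c i \<in> K) \<and> x = (\<Sum>i\<in>I. c i * b i)}"

lemma lin_span_base:
  assumes "subfield K" "finite I" "i \<in> I"
  shows "b i \<in> lin_span K I b"
  unfolding lin_span_def
  by (rule CollectI, rule exI[of _ "\<lambda>j. if j = i then 1 else 0"])
    (use assms in \<open>auto simp: subfield_0 subfield_1 if_distrib[of "\<lambda>x. x * _"] cong: if_cong\<close>)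

lemma lin_span_scale:
  assumes "subfield K" "c \<in> K" "x \<in> lin_span K I b"
  shows "c * x \<in> lin_span K I b"
proof -
  from assms(3) obtain e where "\<forall>i\<in>I. e i \<in> K" "x = (\<Sum>i\<in>I. e i * b i)"
    unfolding lin_span_def by blast
  then show ?thesis
    unfolding lin_span_def using assms(1,2)
    by (auto intro!: exI[of _ "\<lambda>i. c * e i"] subfield_mult simp: sum_distrib_left mult.assoc)
qed

lemma lin_span_sum:
  assumes K: "subfield K" and "\<And>j. j \<in> J \<Longrightarrow> f j \<in> lin_span K I b"
  shows "sum f J \<in> lin_span K I b"
proof -
  from assms(2) obtain e where e: "\<And>j. j \<in> J \<Longrightarrow> (\<forall>i\<in>I. e j i \<in> K) \<and> f j = (\<Sum>i\<in>I. e j i * b i)"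
    unfolding lin_span_def by simp metis
  have "sum f J = (\<Sum>j\<in>J. \<Sum>i\<in>I. e j i * b i)"
    by (intro sum.cong refl) (use e in auto)
  also have "\<dots> = (\<Sum>i\<in>I. (\<Sum>j\<in>J. e j i) * b i)"
    by (subst sum.swap) (simp add: sum_distrib_right)
  finally show ?thesis
    unfolding lin_span_def using e
    by (auto intro!: exI[of _ "\<lambda>i. \<Sum>j\<in>J. e j i"] subfield_sum[OF K])
qed

text \<open>
  All powers of \<open>y\<close> lie in one finite-dimensional space, so they are linearly dependent.
\<close>

lemma algebraic_over_if_stable_span:
  assumes K: "subfield K" and I: "finite I" and one: "1 \<in> lin_span K I b"
    and stable: "\<And>i. i \<in> I \<Longrightarrow> y * b i \<in> lin_span K I b"
  shows "algebraic_over K y"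
proof -
  have "y ^ n \<in> lin_span K I b" for n
  proof (induction n)
    case (Suc n)
    then obtain c where c: "\<forall>i\<in>I. c i \<in> K" "y ^ n = (\<Sum>i\<in>I. c i * b i)"
      unfolding lin_span_def by blast
    then have "y ^ Suc n = (\<Sum>i\<in>I. c i * (y * b i))"
      by (simp add: sum_distrib_left mult.left_commute)
    also have "\<dots> \<in> lin_span K I b"
      by (rule lin_span_sum[OF K], rule lin_span_scale[OF K]) (use c stable in auto)
    finally show ?case .
  qed (use one in simp)
  then obtain v where v: "\<And>n. (\<forall>i\<in>I. v n i \<in> K) \<and> y ^ n = (\<Sum>i\<in>I. v n i * b i)"
    unfolding lin_span_def by simp metis
  let ?J = "{..card I}"
  obtain c where c: "\<forall>j\<in>?J. c j \<in> K" "\<exists>j\<in>?J. c j \<noteq> 0" "\<forall>i\<in>I. (\<Sum>j\<in>?J. c j * v j i) = 0"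
    using homogeneous_system_solvable[OF K I, of ?J v] v by auto
  define p where "p = (\<Sum>j\<in>?J. monom (c j) j)"
  have coeff: "coeff p j = (if j \<in> ?J then c j else 0)" for j
    unfolding p_def by (auto simp: coeff_sum if_distrib cong: if_cong)
  have "p \<in> polys_over K"
    unfolding p_def using c(1) by (intro polys_over_intros K) auto
  moreover have "p \<noteq> 0" using c(2) coeff by (metis coeff_0)
  moreover have "poly p y = 0"
  proof -
    have "poly p y = (\<Sum>j\<in>?J. c j * (\<Sum>i\<in>I. v j i * b i))"
      unfolding p_def poly_sum poly_monom using v by (intro sum.cong refl) metis
    also have "\<dots> = (\<Sum>i\<in>I. (\<Sum>j\<in>?J. c j * v j i) * b i)"
      unfolding sum_distrib_left sum_distrib_right by (subst sum.swap) (simp add: mult.assoc)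
    also have "\<dots> = 0" using c(3) by simp
    finally show ?thesis .
  qed
  ultimately show ?thesis unfolding algebraic_over_iff[OF K] by blast
qed

lemma poly_eq_sum_lessThan: "degree p < d \<Longrightarrow> poly p (x::'a::field) = (\<Sum>i<d. coeff p i * x ^ i)"
  unfolding poly_altdef by (rule sum.mono_neutral_left) (auto simp: coeff_eq_0)

text \<open>
  The products \<open>t\<^sup>i y\<^sup>j\<close> below the two degrees span a space that is stable under multiplication by \<open>y\<close>.
\<close>

lemma algebraic_over_trans:
  assumes K: "subfield K" and t: "algebraic_over K t" and y: "algebraic_over (adjoin K {t}) y"
  shows "algebraic_over K y"
proof -
  let ?F = "adjoin K {t}"
  obtain q where q: "is_min_poly K t q" using min_poly_exists[OF K t] .
  obtain r where r: "is_min_poly ?F y r" using min_poly_exists[OF subfield_adjoin y] .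
  define I where "I = {..<degree q} \<times> {..<degree r}"
  define b where "b = (\<lambda>(i, j). t ^ i * y ^ j)"
  let ?S = "lin_span K I b"
  have F: "c * y ^ j \<in> ?S" if c: "c \<in> ?F" and j: "j < degree r" for c j
  proof -
    obtain p where p: "p \<in> polys_over K" "degree p < degree q" "c = poly p t"
      using c adjoin_algebraic_iff[OF K q] by blast
    then have "c * y ^ j = (\<Sum>i<degree q. coeff p i * b (i, j))"
      by (simp add: poly_eq_sum_lessThan b_def sum_distrib_right mult.assoc)
    also have "\<dots> \<in> ?S"
      using p(1) j by (intro lin_span_sum lin_span_scale lin_span_base K)
        (auto simp: I_def dest: polys_overD)
    finally show ?thesis .
  qed
  have powt: "t ^ i \<in> ?F" for i
    by (rule subfield_power[OF subfield_adjoin generator_in_adjoin])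
  show ?thesis
  proof (rule algebraic_over_if_stable_span[OF K])
    show "finite I" by (simp add: I_def)
    show "1 \<in> ?S"
      using F[OF subfield_1[OF subfield_adjoin], of 0] min_poly_degree_pos[OF r] by simp
    fix ij assume "ij \<in> I"
    then obtain i j where ij: "ij = (i, j)" "j < degree r" by (auto simp: I_def)
    show "y * b ij \<in> ?S"
    proof (cases "Suc j < degree r")
      case True
      then show ?thesis using F[OF powt, of "Suc j" i] by (simp add: ij b_def mult_ac)
    next
      case False
      then have j: "degree r = Suc j" using ij by simp
      have "poly r y = (\<Sum>k<degree r. coeff r k * y ^ k) + y ^ degree r"
        using r unfolding poly_altdef is_min_poly_def
        by (simp add: lessThan_Suc_atMost[symmetric])
      then have "y ^ Suc j = - (\<Sum>k<degree r. coeff r k * y ^ k)"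
        using r j by (simp add: is_min_poly_def add_eq_0_iff)
      then have "y * b ij = - (t ^ i) * (\<Sum>k<degree r. coeff r k * y ^ k)"
        by (simp add: ij b_def mult.left_commute[of y])
      also have "\<dots> = (\<Sum>k<degree r. (- (t ^ i) * coeff r k) * y ^ k)"
        by (simp add: sum_distrib_left sum_negf mult.assoc)
      also have "\<dots> \<in> ?S"
        using r powt by (intro lin_span_sum F K)
          (auto simp: is_min_poly_def intro!: subfield_mult[OF subfield_adjoin] subfield_uminus[OF subfield_adjoin] dest: polys_overD)
      finally show ?thesis .
    qed
  qed
qed

section \<open>Clearing denominators, and the exchange property\<close>

lemma common_denominator:
  assumes G: "subfield G" and p: "p \<in> polys_over (adjoin G {y})"
  shows "\<exists>b\<in>polys_over G. \<exists>q\<in>polys_over (polys_over G).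
    poly b y \<noteq> 0 \<and> smult (poly b y) p = map_poly (\<lambda>a. poly a y) q"
  using p
proof (induction p)
  case 0
  then show ?case
    by (intro bexI[of _ 1] bexI[of _ 0])
      (auto simp: polys_over_0[OF G] polys_over_1[OF G] polys_over_def[of "polys_over G"])
next
  case (pCons a p)
  have "a \<in> adjoin G {y}" "p \<in> polys_over (adjoin G {y})"
    using pCons.prems[THEN polys_overD, of 0] pCons.prems[THEN polys_overD, of "Suc _"]
    by (auto intro: polys_overI)
  moreover have "\<exists>A\<in>polys_over G. \<exists>B\<in>polys_over G. poly B y \<noteq> 0 \<and> a * poly B y = poly A y"
  proof -
    obtain A B where AB: "A \<in> polys_over G" "B \<in> polys_over G" "a = poly A y / poly B y"
      using \<open>a \<in> _\<close> adjoin_iff_fraction[OF G] by blast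
    show ?thesis
    proof (cases "poly B y = 0")
      case True
      then show ?thesis using AB
        by (intro bexI[of _ 0] bexI[of _ 1]) (auto intro: polys_over_0[OF G] polys_over_1[OF G])
    next
      case False
      then show ?thesis using AB by (intro bexI[of _ A] bexI[of _ B]) auto
    qed
  qed
  ultimately obtain A B b q where AB: "A \<in> polys_over G" "B \<in> polys_over G" "poly B y \<noteq> 0"
    "a * poly B y = poly A y" and bq: "b \<in> polys_over G" "q \<in> polys_over (polys_over G)"
    "poly b y \<noteq> 0" "smult (poly b y) p = map_poly (\<lambda>a. poly a y) q"
    using pCons.IH by blast
  have "smult (poly (b * B) y) (pCons a p) = map_poly (\<lambda>a. poly a y) (pCons (A * b) (smult B q))"
    using AB(4) bq(4) by (simp add: map_poly_pCons map_poly_smult mult.commute[of "poly b y"]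
        flip: smult_smult) (metis mult.left_commute mult.commute)
  moreover have "pCons (A * b) (smult B q) \<in> polys_over (polys_over G)"
    using AB bq by (auto simp: polys_over_def[of "polys_over G"] coeff_pCons split: nat.splits
        intro!: polys_over_mult[OF G])
  moreover have "b * B \<in> polys_over G" "poly (b * B) y \<noteq> 0"
    using AB bq polys_over_mult[OF G] by auto
  ultimately show ?case by blast
qed

text \<open>
  Evaluating a bivariate polynomial \<open>q\<close> at the constant polynomial \<open>[:x:]\<close> exchanges the roles of
  its two variables.
\<close>

lemma coeff_poly_const: "coeff (poly q [:x:]) j = poly (map_poly (\<lambda>a. coeff a j) q) x"
  by (induction q) (simp_all add: map_poly_pCons)

lemma poly_poly_const: "poly (poly q [:x:]) s = poly (map_poly (\<lambda>a. poly a s) q) x"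
  by (induction q) (simp_all add: map_poly_pCons)

lemma poly_bivariate_in_polys_over:
  assumes "subfield L" "q \<in> polys_over (polys_over L)" "x \<in> L"
  shows "poly q [:x:] \<in> polys_over L"
  using assms(2)
  by (intro polys_overI) (auto simp: coeff_poly_const coeff_map_poly polys_over_def
      intro!: poly_in_subfield assms)

text \<open>
  An algebraic relation between \<open>s\<close> and \<open>x\<close> over \<open>G\<close> is a polynomial equation for \<open>s\<close> over
  \<open>G(x)\<close>. If that equation is trivial, then its coefficients vanish, and they are polynomials in
  \<open>x\<close> over \<open>G\<close>.
\<close>

lemma algebraic_exchange:
  assumes G: "subfield G" and x: "algebraic_over (adjoin G {s}) x"
  shows "algebraic_over G x \<or> algebraic_over (adjoin G {x}) s"
proof -
  obtain p where p: "p \<in> polys_over (adjoin G {s})" "p \<noteq> 0" "poly p x = 0"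
    using x algebraic_over_iff[OF subfield_adjoin] by blast
  obtain b q where bq: "q \<in> polys_over (polys_over G)" "poly b s \<noteq> 0"
    "smult (poly b s) p = map_poly (\<lambda>a. poly a s) q"
    using common_denominator[OF G p(1)] by blast
  have "poly (poly q [:x:]) s = 0"
    using p(3) unfolding poly_poly_const bq(3)[symmetric] by simp
  moreover have "poly q [:x:] \<in> polys_over (adjoin G {x})"
    using polys_over_mono[OF polys_over_mono[OF subset_adjoin]] bq(1)
    by (intro poly_bivariate_in_polys_over subfield_adjoin generator_in_adjoin) blast
  moreover have "algebraic_over G x" if 0: "poly q [:x:] = 0"
  proof -
    have "q \<noteq> 0" using bq p by auto
    then obtain i j where "coeff (coeff q i) j \<noteq> 0" by (metis coeff_0 poly_eqI)
    then have "map_poly (\<lambda>a. coeff a j) q \<noteq> 0" by (metis coeff_0 coeff_map_poly)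
    moreover have "poly (map_poly (\<lambda>a. coeff a j) q) x = 0"
      using 0 by (simp flip: coeff_poly_const)
    moreover have "map_poly (\<lambda>a. coeff a j) q \<in> polys_over G"
      using bq(1) by (auto simp: polys_over_def coeff_map_poly)
    ultimately show ?thesis unfolding algebraic_over_iff[OF G] by blast
  qed
  ultimately show ?thesis unfolding algebraic_over_iff[OF subfield_adjoin] by blast
qed

section \<open>Derivations\<close>

context
  fixes D :: "'a::field \<Rightarrow> 'a"
  assumes D: "derivation D"
begin

lemma deriv_add: "D (x + y) = D x + D y"
  and deriv_mult: "D (x * y) = D x * y + x * D y"
  using D unfolding derivation_def by auto

lemma deriv_0: "D 0 = 0"
  using deriv_add[of 0 0] by (metis add_0 add_cancel_right_right)

lemma deriv_1: "D 1 = 0"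
  using deriv_mult[of 1 1] by (metis add_cancel_right_right mult_1 mult_1_right)

lemma deriv_uminus: "D (- x) = - D x"
  using deriv_add[of x "- x"] deriv_0 by (simp add: eq_neg_iff_add_eq_0 add.commute)

lemma deriv_diff: "D (x - y) = D x - D y"
  using deriv_add[of x "- y"] deriv_uminus by simp

lemma deriv_sum: "D (sum f I) = (\<Sum>i\<in>I. D (f i))"
  by (induction I rule: infinite_finite_induct) (auto simp: deriv_0 deriv_add)

lemma deriv_of_nat: "D (of_nat n) = 0"
  by (induction n) (auto simp: deriv_0 deriv_1 deriv_add)

lemma deriv_of_int: "D (of_int n) = 0"
  by (cases n) (simp_all add: deriv_of_nat deriv_uminus deriv_diff deriv_1 deriv_add)

lemma deriv_divide: "y \<noteq> 0 \<Longrightarrow> D (x / y) = (D x - x / y * D y) / y"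
  using deriv_mult[of "x / y" y] by (simp add: field_simps)

lemma deriv_power: "D (x ^ n) = of_nat n * x ^ (n - 1) * D x"
proof (induction n)
  case (Suc n)
  then show ?case by (cases n) (auto simp: deriv_mult algebra_simps)
qed (simp add: deriv_1)

lemma deriv_power_exponential: "D x = a * x \<Longrightarrow> D (x ^ n) = of_nat n * a * x ^ n"
  unfolding deriv_power by (cases n) (auto simp: mult_ac)

lemma deriv_divide_exponentials:
  assumes "D x = a * x" "D c = a * c"
  shows "D (x / c) = 0"
  using assms by (cases "c = 0") (simp_all add: deriv_divide deriv_0)

lemma deriv_poly: "D (poly p x) = poly (map_poly D p + pderiv p * [:D x:]) x"
  by (induction p) (auto simp: deriv_0 map_poly_pCons pderiv_pCons deriv_add deriv_mult algebra_simps)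

lemma differential_subfield_adjoin:
  assumes K: "differential_subfield D K" and x: "D x \<in> adjoin K {x}"
  shows "differential_subfield D (adjoin K {x})"
proof -
  let ?F = "adjoin K {x}"
  note F = subfield_adjoin[of K "{x}"]
  have "?F \<subseteq> {z \<in> ?F. D z \<in> ?F}"
  proof (rule adjoin_least)
    show "K \<subseteq> {z \<in> ?F. D z \<in> ?F}"
      using K subset_adjoin[of K "{x}"] unfolding differential_subfield_def by blast
    show "{x} \<subseteq> {z \<in> ?F. D z \<in> ?F}" using x generator_in_adjoin by auto
    have "D (inverse z) \<in> ?F" if "z \<in> ?F" "D z \<in> ?F" for z
    proof (cases "z = 0")
      case False
      then show ?thesis
        using deriv_divide[of z 1] that F by (simp add: deriv_1 inverse_eq_divide subfield_intros)
    qed (simp add: deriv_0 subfield_0[OF F])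
    then show "subfield {z \<in> ?F. D z \<in> ?F}"
      unfolding subfield_def
      by (auto simp: deriv_0 deriv_1 deriv_add deriv_mult deriv_uminus intro!: subfield_intros F)
  qed
  then show ?thesis using F unfolding differential_subfield_def by blast
qed

end

text \<open>
  The trace of a finite extension, divided by the degree. The trace commutes with the derivation
  because differentiating the basis changes the matrix of a multiplication by a commutator.
\<close>

lemma normalised_trace_exists:
  fixes D :: "'a::field_char_0 \<Rightarrow> 'a"
  assumes D: "derivation D" and M: "differential_subfield D M" and s: "algebraic_over M s"
    and N: "differential_subfield D (adjoin M {s})"
  obtains \<tau> where "\<And>x. x \<in> adjoin M {s} \<Longrightarrow> \<tau> x \<in> M"
    "\<And>x y. x \<in> adjoin M {s} \<Longrightarrow> y \<in> adjoin M {s} \<Longrightarrow> \<tau> (x + y) = \<tau> x + \<tau> y"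
    "\<And>c x. c \<in> M \<Longrightarrow> x \<in> adjoin M {s} \<Longrightarrow> \<tau> (c * x) = c * \<tau> x"
    "\<tau> 1 = 1"
    "\<And>x. x \<in> adjoin M {s} \<Longrightarrow> \<tau> (D x) = D (\<tau> x)"
proof -
  let ?N = "adjoin M {s}"
  have sM: "subfield M" and DM: "\<And>x. x \<in> M \<Longrightarrow> D x \<in> M"
    and DN: "\<And>x. x \<in> ?N \<Longrightarrow> D x \<in> ?N"
    using M N by (auto simp: differential_subfield_def)
  note sN = subfield_adjoin[of M "{s}"]
  have MN: "x \<in> ?N" if "x \<in> M" for x using subset_adjoin that by blast
  obtain q where q: "is_min_poly M s q" using min_poly_exists[OF sM s] .
  define d where "d = degree q"
  have d: "d > 0" using min_poly_degree_pos[OF q] by (simp add: d_def)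
  have "\<forall>x\<in>?N. \<exists>p. p \<in> polys_over M \<and> degree p < d \<and> x = poly p s"
    using adjoin_algebraic_iff[OF sM q] unfolding d_def by blast
  then obtain R where R: "\<And>x. x \<in> ?N \<Longrightarrow> R x \<in> polys_over M \<and> degree (R x) < d \<and> x = poly (R x) s"
    by metis
  define \<phi> where "\<phi> x i = coeff (R x) i" for x i
  have \<phi>M: "\<phi> x i \<in> M" if "x \<in> ?N" for x i
    using R[OF that] by (auto simp: \<phi>_def polys_overD)
  have expand: "x = (\<Sum>i<d. \<phi> x i * s ^ i)" if "x \<in> ?N" for x
    using R[OF that] unfolding \<phi>_def by (metis poly_eq_sum_lessThan)
  have unique: "\<phi> x j = c j" if x: "x = (\<Sum>i<d. c i * s ^ i)" and c: "\<And>i. i < d \<Longrightarrow> c i \<in> M"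
    and j: "j < d" for x c j
  proof -
    define p where "p = (\<Sum>i<d. monom (c i) i)"
    have p: "p \<in> polys_over M" unfolding p_def using c by (intro polys_over_intros sM) auto
    have coeff: "coeff p i = (if i < d then c i else 0)" for i
      unfolding p_def by (auto simp: coeff_sum if_distrib cong: if_cong)
    have degp: "degree p < d" using d by (intro degree_lessI) (auto simp: coeff)
    have "x = poly p s" using x poly_eq_sum_lessThan[OF degp] coeff by simp
    moreover from this have "x \<in> ?N" using p poly_in_adjoin by blast
    ultimately have "R x - p \<in> polys_over M" "poly (R x - p) s = 0" "degree (R x - p) < d"
      using R[of x] p degp by (auto intro: polys_over_diff[OF sM] degree_diff_less)
    then have "R x = p" using q unfolding is_min_poly_def d_def by auto
    then show ?thesis using coeff j by (simp add: \<phi>_def)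
  qed
  have powN: "s ^ i \<in> ?N" for i by (rule subfield_power[OF sN generator_in_adjoin])
  have add: "\<phi> (x + y) j = \<phi> x j + \<phi> y j" if "x \<in> ?N" "y \<in> ?N" "j < d" for x y j
  proof (rule unique)
    show "x + y = (\<Sum>i<d. (\<phi> x i + \<phi> y i) * s ^ i)"
      using expand[OF that(1)] expand[OF that(2)] by (simp add: algebra_simps sum.distrib)
  qed (use that \<phi>M sM in \<open>auto intro: subfield_intros\<close>)
  have scale: "\<phi> (c * x) j = c * \<phi> x j" if "c \<in> M" "x \<in> ?N" "j < d" for c x j
  proof (rule unique)
    show "c * x = (\<Sum>i<d. (c * \<phi> x i) * s ^ i)"
      by (subst expand[OF that(2)]) (simp add: sum_distrib_left mult.assoc)
  qed (use that \<phi>M sM in \<open>auto intro: subfield_intros\<close>)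
  have sum\<phi>: "\<phi> (\<Sum>i\<in>I. f i) j = (\<Sum>i\<in>I. \<phi> (f i) j)"
    if "\<And>i. i \<in> I \<Longrightarrow> f i \<in> ?N" "j < d" "finite I" for I :: "nat set" and f j
    using that(3,1,2)
  proof (induction I rule: finite_induct)
    case empty
    have "\<phi> 0 j = 0" using add[of 0 0 j] that(2) subfield_0[OF sN] by simp
    then show ?case by simp
  next
    case (insert a I)
    then show ?case by (simp add: add subfield_sum[OF sN])
  qed
  \<comment> \<open>The matrix \<open>\<phi> (D (s ^ j)) i\<close> describes how \<open>D\<close> acts on the basis.\<close>
  have D\<phi>: "\<phi> (D z) i = D (\<phi> z i) + (\<Sum>j<d. \<phi> z j * \<phi> (D (s ^ j)) i)"
    if z: "z \<in> ?N" and i: "i < d" for z i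
  proof -
    have "D z = D (\<Sum>j<d. \<phi> z j * s ^ j)" using expand[OF z] by simp
    also have "\<dots> = (\<Sum>j<d. D (\<phi> z j) * s ^ j) + (\<Sum>j<d. \<phi> z j * D (s ^ j))"
      by (simp add: deriv_sum[OF D] deriv_mult[OF D] sum.distrib)
    finally have Dz: "D z = (\<Sum>j<d. D (\<phi> z j) * s ^ j) + (\<Sum>j<d. \<phi> z j * D (s ^ j))" .
    have "\<phi> (\<Sum>j<d. D (\<phi> z j) * s ^ j) i = D (\<phi> z i)"
      by (rule unique[OF refl]) (use i DM \<phi>M z in auto)
    moreover have "\<phi> (\<Sum>j<d. \<phi> z j * D (s ^ j)) i = (\<Sum>j<d. \<phi> z j * \<phi> (D (s ^ j)) i)"
      using i z by (subst sum\<phi>) (auto simp: scale \<phi>M DN powN MN subfield_mult[OF sN])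
    moreover have "(\<Sum>j<d. D (\<phi> z j) * s ^ j) \<in> ?N" "(\<Sum>j<d. \<phi> z j * D (s ^ j)) \<in> ?N"
      by (intro subfield_sum[OF sN] subfield_mult[OF sN] powN MN[OF DM[OF \<phi>M[OF z]]]
          MN[OF \<phi>M[OF z]] DN[OF powN])+
    ultimately show ?thesis
      unfolding Dz using i by (simp add: add)
  qed
  define tr where "tr x = (\<Sum>i<d. \<phi> (x * s ^ i) i)" for x
  have xs: "x * s ^ i \<in> ?N" if "x \<in> ?N" for x i using that powN sN by (auto intro: subfield_mult)
  have trD: "tr (D x) = D (tr x)" if x: "x \<in> ?N" for x
  proof -
    have 1: "\<phi> (D x * s ^ i) i = D (\<phi> (x * s ^ i) i)
        + (\<Sum>j<d. \<phi> (x * s ^ i) j * \<phi> (D (s ^ j)) i) - (\<Sum>j<d. \<phi> (D (s ^ i)) j * \<phi> (x * s ^ j) i)"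
      if i: "i < d" for i
    proof -
      have "x * D (s ^ i) = x * (\<Sum>j<d. \<phi> (D (s ^ i)) j * s ^ j)"
        using expand[OF DN[OF powN]] by simp
      also have "\<dots> = (\<Sum>j<d. \<phi> (D (s ^ i)) j * (x * s ^ j))"
        by (simp add: sum_distrib_left mult.left_commute)
      also have "\<phi> \<dots> i = (\<Sum>j<d. \<phi> (D (s ^ i)) j * \<phi> (x * s ^ j) i)"
        using i x by (subst sum\<phi>) (auto simp: scale \<phi>M DN powN MN xs subfield_mult[OF sN])
      finally have 2: "\<phi> (x * D (s ^ i)) i = (\<Sum>j<d. \<phi> (D (s ^ i)) j * \<phi> (x * s ^ j) i)" .
      have "\<phi> (D (x * s ^ i)) i = \<phi> (D x * s ^ i) i + \<phi> (x * D (s ^ i)) i"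
        unfolding deriv_mult[OF D] using i x
        by (subst add) (auto intro!: subfield_mult[OF sN] DN powN)
      then show ?thesis using D\<phi>[OF xs[OF x] i, of i] 2 by simp
    qed
    have "tr (D x) = (\<Sum>i<d. D (\<phi> (x * s ^ i) i))
        + (\<Sum>i<d. \<Sum>j<d. \<phi> (x * s ^ i) j * \<phi> (D (s ^ j)) i)
        - (\<Sum>i<d. \<Sum>j<d. \<phi> (D (s ^ i)) j * \<phi> (x * s ^ j) i)"
      unfolding tr_def using 1 by (simp add: sum.distrib sum_subtractf)
    \<comment> \<open>The two double sums are the traces of products of the same two matrices in opposite orders.\<close>
    also have "(\<Sum>i<d. \<Sum>j<d. \<phi> (D (s ^ i)) j * \<phi> (x * s ^ j) i) =
        (\<Sum>i<d. \<Sum>j<d. \<phi> (x * s ^ i) j * \<phi> (D (s ^ j)) i)"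
      by (subst sum.swap) (simp add: mult.commute)
    finally show ?thesis by (simp add: tr_def deriv_sum[OF D])
  qed
  have "\<phi> (s ^ i) i = 1" if "i < d" for i
    by (subst unique[where c = "\<lambda>j. if j = i then 1 else 0"])
      (use that in \<open>auto simp: if_distrib[of "\<lambda>x. x * _"] subfield_0[OF sM] subfield_1[OF sM] cong: if_cong\<close>)
  then have tr1: "tr 1 = of_nat d" by (simp add: tr_def)
  define \<tau> where "\<tau> x = tr x / of_nat d" for x
  show thesis
  proof (rule that[of \<tau>])
    show "\<tau> x \<in> M" if "x \<in> ?N" for x
      unfolding \<tau>_def tr_def using that by (intro subfield_intros sM \<phi>M xs)
    show "\<tau> (x + y) = \<tau> x + \<tau> y" if "x \<in> ?N" "y \<in> ?N" for x y
      using that by (simp add: \<tau>_def tr_def distrib_right add xs sum.distrib add_divide_distrib)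
    show "\<tau> (c * x) = c * \<tau> x" if "c \<in> M" "x \<in> ?N" for c x
      using that by (simp add: \<tau>_def tr_def mult.assoc scale xs sum_distrib_left)
    show "\<tau> 1 = 1" using d by (simp add: \<tau>_def tr1)
    show "\<tau> (D x) = D (\<tau> x)" if "x \<in> ?N" for x
      using that d by (simp add: \<tau>_def trD deriv_divide[OF D] deriv_of_nat[OF D])
  qed
qed

section \<open>Laurent expansion of rational functions\<close>

definition fls_of_poly :: "'a::field poly \<Rightarrow> 'a fls" where
  "fls_of_poly p = fps_to_fls (fps_of_poly p)"

lemma fls_of_poly_nth: "fls_of_poly p $$ n = (if n < 0 then 0 else coeff p (nat n))"
  by (simp add: fls_of_poly_def)

lemma fls_of_poly_add: "fls_of_poly (p + q) = fls_of_poly p + fls_of_poly q"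
  and fls_of_poly_diff: "fls_of_poly (p - q) = fls_of_poly p - fls_of_poly q"
  and fls_of_poly_mult: "fls_of_poly (p * q) = fls_of_poly p * fls_of_poly q"
  and fls_of_poly_const: "fls_of_poly [:c:] = fls_const c"
  and fls_of_poly_0: "fls_of_poly 0 = 0"
  and fls_of_poly_1: "fls_of_poly 1 = 1"
  and fls_of_poly_eq_iff: "fls_of_poly p = fls_of_poly q \<longleftrightarrow> p = q"
  and fls_of_poly_pderiv: "fls_of_poly (pderiv p) = fls_deriv (fls_of_poly p)"
  by (simp_all add: fls_of_poly_def fps_of_poly_add fps_of_poly_diff fps_of_poly_mult
      fls_times_fps_to_fls fps_of_poly_const fps_of_poly_eq_iff fps_of_poly_pderiv
      fls_deriv_fps_to_fls)

lemma fls_of_poly_eq_0_iff: "fls_of_poly p = 0 \<longleftrightarrow> p = 0"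
  using fls_of_poly_eq_iff[of p 0] by (simp add: fls_of_poly_0)

lemma fls_of_poly_monom_times_nth: "(fls_of_poly (monom c i) * f) $$ n = c * f $$ (n - int i)"
  by (simp add: fls_of_poly_def fps_of_poly_monom fls_times_fps_to_fls fps_to_fls_power
      mult.assoc fls_X_power_times_conv_shift(1))

lemma fls_of_poly_times_nth:
  "(fls_of_poly p * f) $$ n = (\<Sum>i\<le>degree p. coeff p i * f $$ (n - int i))"
proof -
  have "(fls_of_poly (\<Sum>i\<in>I. monom (coeff p i) i) * f) $$ n = (\<Sum>i\<in>I. coeff p i * f $$ (n - int i))"
    if "finite I" for I
    using that by (induction I rule: finite_induct)
      (auto simp: fls_of_poly_0 fls_of_poly_add distrib_right fls_of_poly_monom_times_nth)
  from this[of "{..degree p}"] show ?thesis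
    by (simp add: poly_as_sum_of_monoms)
qed

lemma fls_of_map_poly_times_nth:
  assumes "h 0 = 0"
  shows "(fls_of_poly (map_poly h p) * f) $$ n = (\<Sum>i\<le>degree p. h (coeff p i) * f $$ (n - int i))"
proof -
  have 0: "coeff (map_poly h p) i = 0 \<longleftrightarrow> h (coeff p i) = 0" for i
    by (simp add: coeff_map_poly assms)
  have "degree (map_poly h p) \<le> degree p"
    by (rule degree_le) (auto simp: coeff_map_poly assms coeff_eq_0)
  then show ?thesis
    unfolding fls_of_poly_times_nth
    by (intro sum.mono_neutral_cong_left) (auto simp: 0[symmetric] coeff_eq_0, simp add: coeff_map_poly assms)
qed

definition fls_map :: "('a::zero \<Rightarrow> 'b::zero) \<Rightarrow> 'a fls \<Rightarrow> 'b fls" where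
  "fls_map h f = Abs_fls (\<lambda>n. h (f $$ n))"

lemma fls_map_nth: "h 0 = 0 \<Longrightarrow> fls_map h f $$ n = h (f $$ n)"
  unfolding fls_map_def
  by (rule nth_Abs_fls_lower_bound[of "fls_subdegree f"]) (simp add: fls_eq0_below_subdegree)

text \<open>
  The derivation of Laurent series that extends the coefficientwise action of \<open>D\<close> and sends the
  variable to \<open>P\<close>.
\<close>

definition fls_twisted_deriv :: "('a::field \<Rightarrow> 'a) \<Rightarrow> 'a poly \<Rightarrow> 'a fls \<Rightarrow> 'a fls" where
  "fls_twisted_deriv D P f = fls_map D f + fls_of_poly P * fls_deriv f"

lemma fls_twisted_deriv_nth:
  assumes "derivation D"
  shows "fls_twisted_deriv D P f $$ n =
    D (f $$ n) + (\<Sum>i\<le>degree P. coeff P i * (of_int (n - int i + 1) * f $$ (n - int i + 1)))"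
  by (simp add: fls_twisted_deriv_def fls_map_nth[of D] deriv_0[OF assms] fls_of_poly_times_nth)

lemma fls_twisted_deriv_poly_times:
  assumes D: "derivation D"
  shows "fls_twisted_deriv D P (fls_of_poly B * f) =
    fls_of_poly (map_poly D B + pderiv B * P) * f + fls_of_poly B * fls_twisted_deriv D P f"
proof -
  have "fls_map D (fls_of_poly B * f) = fls_of_poly (map_poly D B) * f + fls_of_poly B * fls_map D f"
  proof (rule fls_eqI)
    fix n
    show "fls_map D (fls_of_poly B * f) $$ n =
        (fls_of_poly (map_poly D B) * f + fls_of_poly B * fls_map D f) $$ n"
      unfolding fls_plus_nth fls_of_map_poly_times_nth[of D, OF deriv_0[OF D]]
      by (simp add: fls_map_nth[of D] deriv_0[OF D] fls_of_poly_times_nth deriv_sum[OF D] deriv_mult[OF D] sum.distrib)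
  qed
  then show ?thesis
    by (simp add: fls_twisted_deriv_def fls_of_poly_add fls_of_poly_mult fls_of_poly_pderiv
        algebra_simps)
qed

lemma fls_twisted_deriv_poly:
  assumes D: "derivation D"
  shows "fls_twisted_deriv D P (fls_of_poly B) = fls_of_poly (map_poly D B + pderiv B * P)"
proof -
  have "fls_map D (1 :: 'a fls) = 0"
    by (rule fls_eqI) (simp add: fls_map_nth[of D] deriv_0[OF D] deriv_1[OF D])
  then have "fls_twisted_deriv D P 1 = 0" by (simp add: fls_twisted_deriv_def)
  then show ?thesis using fls_twisted_deriv_poly_times[OF D, of P B 1] by simp
qed

text \<open>
  \<open>expands M x T f\<close>: \<open>T\<close> is a rational function of \<open>x\<close> over \<open>M\<close> and \<open>f\<close> is its Laurent series at
  \<open>x = 0\<close>. For transcendental \<open>x\<close> this is the graph of an embedding of \<open>M(x)\<close> into the field of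
  Laurent series.
\<close>

definition expands :: "'a::field set \<Rightarrow> 'a \<Rightarrow> 'a \<Rightarrow> 'a fls \<Rightarrow> bool" where
  "expands M x T f \<longleftrightarrow> (\<exists>A\<in>polys_over M. \<exists>B\<in>polys_over M.
     poly B x \<noteq> 0 \<and> poly B x * T = poly A x \<and> fls_of_poly B * f = fls_of_poly A)"

lemma expandsI:
  "A \<in> polys_over M \<Longrightarrow> B \<in> polys_over M \<Longrightarrow> poly B x \<noteq> 0 \<Longrightarrow> poly B x * T = poly A x \<Longrightarrow>
   fls_of_poly B * f = fls_of_poly A \<Longrightarrow> expands M x T f"
  unfolding expands_def by blast

lemma expandsE:
  assumes "expands M x T f"
  obtains A B where "A \<in> polys_over M" "B \<in> polys_over M" "poly B x \<noteq> 0"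
    "poly B x * T = poly A x" "fls_of_poly B * f = fls_of_poly A"
  using assms unfolding expands_def by blast

lemma expands_mono: "M \<subseteq> M' \<Longrightarrow> expands M x T f \<Longrightarrow> expands M' x T f"
  using polys_over_mono[of M M'] unfolding expands_def by blast

context
  fixes M :: "'a::field set" and x :: 'a
  assumes M: "subfield M"
begin

lemma expands_exists:
  assumes "T \<in> adjoin M {x}"
  shows "\<exists>f. expands M x T f"
proof -
  obtain A B where AB: "A \<in> polys_over M" "B \<in> polys_over M" "T = poly A x / poly B x"
    using assms adjoin_iff_fraction[OF M] by blast
  show ?thesis
  proof (cases "poly B x = 0")
    case True
    then show ?thesis
      using AB M by (intro exI[of _ 0] expandsI[of 0 _ 1]) (auto simp: polys_over_intros fls_of_poly_0)
  next
    case False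
    then have "fls_of_poly B \<noteq> 0" by (auto simp: fls_of_poly_eq_0_iff)
    then show ?thesis
      using AB False by (intro exI[of _ "fls_of_poly A / fls_of_poly B"] expandsI[of A _ B]) auto
  qed
qed

lemma expands_in_adjoin: "expands M x T f \<Longrightarrow> T \<in> adjoin M {x}"
  by (erule expandsE) (metis nonzero_mult_div_cancel_left poly_in_adjoin subfield_divide[OF subfield_adjoin])

lemma expands_const: "c \<in> M \<Longrightarrow> expands M x c (fls_const c)"
  by (rule expandsI[of "[:c:]" _ 1]) (auto simp: polys_over_intros[OF M] fls_of_poly_const fls_of_poly_1)

lemma expands_mult:
  assumes "expands M x T f" "expands M x U g"
  shows "expands M x (T * U) (f * g)"
proof -
  obtain A B where AB: "A \<in> polys_over M" "B \<in> polys_over M" "poly B x \<noteq> 0"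
    "poly B x * T = poly A x" "fls_of_poly B * f = fls_of_poly A"
    using assms(1) by (rule expandsE)
  obtain A' B' where AB': "A' \<in> polys_over M" "B' \<in> polys_over M" "poly B' x \<noteq> 0"
    "poly B' x * U = poly A' x" "fls_of_poly B' * g = fls_of_poly A'"
    using assms(2) by (rule expandsE)
  show ?thesis
  proof (rule expandsI)
    show "A * A' \<in> polys_over M" "B * B' \<in> polys_over M"
      using AB AB' by (auto intro: polys_over_mult[OF M])
    show "poly (B * B') x \<noteq> 0" using AB AB' by simp
    show "poly (B * B') x * (T * U) = poly (A * A') x"
      by (simp add: AB(4)[symmetric] AB'(4)[symmetric] mult_ac)
    show "fls_of_poly (B * B') * (f * g) = fls_of_poly (A * A')"
      by (simp add: fls_of_poly_mult AB(5)[symmetric] AB'(5)[symmetric] mult_ac)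
  qed
qed

lemma expands_add:
  assumes "expands M x T f" "expands M x U g"
  shows "expands M x (T + U) (f + g)"
proof -
  obtain A B where AB: "A \<in> polys_over M" "B \<in> polys_over M" "poly B x \<noteq> 0"
    "poly B x * T = poly A x" "fls_of_poly B * f = fls_of_poly A"
    using assms(1) by (rule expandsE)
  obtain A' B' where AB': "A' \<in> polys_over M" "B' \<in> polys_over M" "poly B' x \<noteq> 0"
    "poly B' x * U = poly A' x" "fls_of_poly B' * g = fls_of_poly A'"
    using assms(2) by (rule expandsE)
  show ?thesis
  proof (rule expandsI)
    show "A * B' + A' * B \<in> polys_over M" "B * B' \<in> polys_over M"
      using AB AB' by (auto intro!: polys_over_mult[OF M] polys_over_add[OF M])
    show "poly (B * B') x \<noteq> 0" using AB AB' by simp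
    show "poly (B * B') x * (T + U) = poly (A * B' + A' * B) x"
      by (simp add: AB(4)[symmetric] AB'(4)[symmetric] algebra_simps)
    show "fls_of_poly (B * B') * (f + g) = fls_of_poly (A * B' + A' * B)"
      by (simp add: fls_of_poly_mult fls_of_poly_add AB(5)[symmetric] AB'(5)[symmetric] algebra_simps)
  qed
qed

text \<open>
  If \<open>r\<close> is the order of the denominator \<open>B\<close>, then the coefficient of index \<open>n + r\<close> in \<open>B f = A\<close>
  determines the coefficient of index \<open>n\<close> in \<open>f\<close> from the earlier ones.
\<close>

lemma expands_coeff_in:
  assumes "expands M x T f"
  shows "f $$ n \<in> M"
proof -
  obtain A B where AB: "A \<in> polys_over M" "B \<in> polys_over M" "poly B x \<noteq> 0"
    "fls_of_poly B * f = fls_of_poly A"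
    using assms by (rule expandsE)
  define r where "r = (LEAST r. coeff B r \<noteq> 0)"
  have "\<exists>r. coeff B r \<noteq> 0" using AB(3) by (metis coeff_0 poly_0 poly_eqI)
  then have r: "coeff B r \<noteq> 0" unfolding r_def by (rule LeastI_ex)
  have low: "coeff B i = 0" if "i < r" for i using that not_less_Least unfolding r_def by blast
  have "f $$ (fls_subdegree f + int k) \<in> M" for k
  proof (induction k rule: less_induct)
    case (less k)
    let ?n = "fls_subdegree f + int k"
    have IH: "f $$ j \<in> M" if "j < ?n" for j
    proof (cases "j < fls_subdegree f")
      case True
      then show ?thesis by (simp add: fls_eq0_below_subdegree subfield_0[OF M])
    next
      case False
      then show ?thesis using less[of "nat (j - fls_subdegree f)"] that by auto
    qed
    have "r \<le> degree B" using r by (rule le_degree)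
    then have eq: "fls_of_poly A $$ (?n + int r) = coeff B r * f $$ ?n
        + (\<Sum>i\<in>{..degree B} - {r}. coeff B i * f $$ (?n + int r - int i))"
      unfolding AB(4)[symmetric] fls_of_poly_times_nth by (subst sum.remove[of _ r]) auto
    have S: "(\<Sum>i\<in>{..degree B} - {r}. coeff B i * f $$ (?n + int r - int i)) \<in> M"
    proof (rule subfield_sum[OF M])
      fix i assume "i \<in> {..degree B} - {r}"
      then consider "i < r" | "i > r" by fastforce
      then show "coeff B i * f $$ (?n + int r - int i) \<in> M"
        by cases (auto simp: low subfield_0[OF M] intro!: subfield_mult[OF M] polys_overD[OF AB(2)] IH)
    qed
    have A: "fls_of_poly A $$ (?n + int r) \<in> M"
      using AB(1) by (auto simp: fls_of_poly_nth subfield_0[OF M] dest: polys_overD)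
    have "coeff B r * f $$ ?n \<in> M"
      using subfield_diff[OF M A S] by (simp only: eq add_diff_cancel_right')
    then have "coeff B r * f $$ ?n / coeff B r \<in> M"
      using subfield_divide[OF M] polys_overD[OF AB(2)] by blast
    then show ?case using r by simp
  qed
  from this[of "nat (n - fls_subdegree f)"] show ?thesis
    by (cases "n < fls_subdegree f") (simp_all add: fls_eq0_below_subdegree subfield_0[OF M])
qed

context
  assumes trans: "\<not> algebraic_over M x"
begin

lemma expands_unique:
  assumes "expands M x T f" "expands M x T g"
  shows "f = g"
proof -
  obtain A B where AB: "A \<in> polys_over M" "B \<in> polys_over M" "poly B x \<noteq> 0"
    "poly B x * T = poly A x" "fls_of_poly B * f = fls_of_poly A"
    using assms(1) by (rule expandsE)
  obtain A' B' where AB': "A' \<in> polys_over M" "B' \<in> polys_over M" "poly B' x \<noteq> 0"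
    "poly B' x * T = poly A' x" "fls_of_poly B' * g = fls_of_poly A'"
    using assms(2) by (rule expandsE)
  have "poly (A * B' - A' * B) x = 0"
    by (simp add: AB(4)[symmetric] AB'(4)[symmetric] mult_ac)
  moreover have "A * B' - A' * B \<in> polys_over M"
    using AB AB' by (auto intro!: polys_over_mult[OF M] polys_over_diff[OF M])
  ultimately have "A * B' - A' * B = 0"
    using transcendental_poly_eq_0[OF M trans] by blast
  then have "A * B' = A' * B" by simp
  then have "fls_of_poly A * fls_of_poly B' = fls_of_poly A' * fls_of_poly B"
    by (simp flip: fls_of_poly_mult)
  then have "fls_of_poly B * fls_of_poly B' * f = fls_of_poly B * fls_of_poly B' * g"
    unfolding AB(5)[symmetric] AB'(5)[symmetric] by (simp add: mult_ac)
  moreover have "fls_of_poly B \<noteq> 0" "fls_of_poly B' \<noteq> 0"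
    using AB AB' by (auto simp: fls_of_poly_eq_0_iff)
  ultimately show ?thesis by simp
qed

lemma expands_inj:
  assumes "expands M x T f" "expands M x U f"
  shows "T = U"
proof -
  obtain A B where AB: "A \<in> polys_over M" "B \<in> polys_over M" "poly B x \<noteq> 0"
    "poly B x * T = poly A x" "fls_of_poly B * f = fls_of_poly A"
    using assms(1) by (rule expandsE)
  obtain A' B' where AB': "A' \<in> polys_over M" "B' \<in> polys_over M" "poly B' x \<noteq> 0"
    "poly B' x * U = poly A' x" "fls_of_poly B' * f = fls_of_poly A'"
    using assms(2) by (rule expandsE)
  have "fls_of_poly (A * B') = fls_of_poly (A' * B)"
    unfolding fls_of_poly_mult AB(5)[symmetric] AB'(5)[symmetric] by (simp add: mult_ac)
  then have "A * B' = A' * B" by (simp add: fls_of_poly_eq_iff)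
  then have "poly A x * poly B' x = poly A' x * poly B x" by (metis poly_mult)
  then have "poly B x * poly B' x * T = poly B x * poly B' x * U"
    unfolding AB(4)[symmetric] AB'(4)[symmetric] by (simp add: mult_ac)
  then show ?thesis using AB AB' by simp
qed

end

lemma expands_deriv:
  assumes D: "derivation D" and DM: "\<And>c. c \<in> M \<Longrightarrow> D c \<in> M"
    and P: "P \<in> polys_over M" "D x = poly P x" and T: "expands M x T f"
  shows "expands M x (D T) (fls_twisted_deriv D P f)"
proof -
  obtain A B where AB: "A \<in> polys_over M" "B \<in> polys_over M" "poly B x \<noteq> 0"
    "poly B x * T = poly A x" "fls_of_poly B * f = fls_of_poly A"
    using T by (rule expandsE)
  define d where "d p = map_poly D p + pderiv p * P" for p
  have d: "d p \<in> polys_over M" if "p \<in> polys_over M" for p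
  proof -
    have "map_poly D p \<in> polys_over M"
      using that DM by (auto simp: polys_over_def coeff_map_poly deriv_0[OF D])
    then show ?thesis
      unfolding d_def using that P by (intro polys_over_intros M)
  qed
  have Dpoly: "D (poly p x) = poly (d p) x" for p
    by (simp add: deriv_poly[OF D] d_def P(2))
  show ?thesis
  proof (rule expandsI)
    show "d A * B - d B * A \<in> polys_over M" "B * B \<in> polys_over M"
      using AB by (auto intro!: polys_over_mult[OF M] polys_over_diff[OF M] d)
    show "poly (B * B) x \<noteq> 0" using AB by simp
    have "poly (d A) x = poly (d B) x * T + poly B x * D T"
      using arg_cong[OF AB(4), of D] by (simp add: deriv_mult[OF D] Dpoly)
    then show "poly (B * B) x * D T = poly (d A * B - d B * A) x"
      by (simp add: AB(4)[symmetric] algebra_simps)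
    have "fls_of_poly (d A) = fls_of_poly (d B) * f + fls_of_poly B * fls_twisted_deriv D P f"
      unfolding d_def
      using fls_twisted_deriv_poly_times[OF D, of P B f] fls_twisted_deriv_poly[OF D, of P A] AB(5)
      by simp
    then show "fls_of_poly (B * B) * fls_twisted_deriv D P f = fls_of_poly (d A * B - d B * A)"
      by (simp add: fls_of_poly_mult fls_of_poly_diff AB(5)[symmetric] algebra_simps)
  qed
qed

end

text \<open>
  The equation \<open>B f = A\<close>, after clearing denominators, is one of polynomials in \<open>y\<close> over \<open>G\<close>; the
  coefficients of a power of \<open>y\<close> that occurs in \<open>B\<close> give an equation of the same form over \<open>G\<close>.
\<close>

lemma rational_over_coefficient_field:
  assumes G: "subfield G" and y: "\<not> algebraic_over G y" and x: "\<not> algebraic_over (adjoin G {y}) x"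
    and T: "expands (adjoin G {y}) x T f" and f: "\<And>n. f $$ n \<in> G"
  shows "T \<in> adjoin G {x}"
proof -
  let ?M = "adjoin G {y}"
  let ?ev = "map_poly (\<lambda>a. poly a y)"
  note M = subfield_adjoin[of G "{y}"]
  have xG: "\<not> algebraic_over G x" using x algebraic_over_mono[OF subset_adjoin] by blast
  obtain A B where AB: "A \<in> polys_over ?M" "B \<in> polys_over ?M" "poly B x \<noteq> 0"
    "poly B x * T = poly A x" "fls_of_poly B * f = fls_of_poly A"
    using T by (rule expandsE)
  obtain b qB where B: "qB \<in> polys_over (polys_over G)" "b \<in> polys_over G" "poly b y \<noteq> 0"
    "smult (poly b y) B = ?ev qB"
    using common_denominator[OF G AB(2)] by blast
  obtain a qA where A: "qA \<in> polys_over (polys_over G)" "a \<in> polys_over G" "poly a y \<noteq> 0"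
    "smult (poly a y) A = ?ev qA"
    using common_denominator[OF G AB(1)] by blast
  have cB: "coeff (coeff qB i) j \<in> G" and cA: "coeff (coeff qA i) j \<in> G" for i j
    using A B by (auto simp: polys_over_def)
  define rB where "rB = smult a qB"
  define rA where "rA = smult b qA"
  have rB: "coeff rB i \<in> polys_over G" and rA: "coeff rA i \<in> polys_over G" for i
    using A B by (auto simp: rB_def rA_def polys_over_def[of "polys_over G"] intro: polys_over_mult[OF G])
  have evB: "?ev rB = smult (poly a y * poly b y) B" and evA: "?ev rA = smult (poly a y * poly b y) A"
    by (simp_all add: rB_def rA_def map_poly_smult A(4)[symmetric] B(4)[symmetric] mult.commute)
  have smult: "fls_of_poly (smult c p) = fls_const c * fls_of_poly p" for c :: 'a and p
    using fls_of_poly_mult[of "[:c:]" p] by (simp add: fls_of_poly_const)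
  have ev_eq: "fls_of_poly (?ev rB) * f = fls_of_poly (?ev rA)"
    unfolding evA evB smult using AB(5) by (simp add: mult.assoc)
  have "B \<noteq> 0" using AB(3) by auto
  then have "rB \<noteq> 0" using evB A(3) B(3) by auto
  then obtain i j where ij: "coeff (coeff rB i) j \<noteq> 0" by (metis coeff_0 poly_eqI)
  define B' where "B' = map_poly (\<lambda>a. coeff a j) rB"
  define A' where "A' = map_poly (\<lambda>a. coeff a j) rA"
  have "B' \<noteq> 0" using ij unfolding B'_def by (metis coeff_0 coeff_map_poly)
  have AB': "A' \<in> polys_over G" "B' \<in> polys_over G"
    using rA rB by (auto simp: A'_def B'_def polys_over_def coeff_map_poly)
  have B'x: "poly B' x \<noteq> 0"
    using \<open>B' \<noteq> 0\<close> AB' transcendental_poly_eq_0[OF G xG] by blast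
  have "fls_of_poly B' * f = fls_of_poly A'"
  proof (rule fls_eqI)
    fix n
    define R where "R = (\<Sum>i\<le>degree rB. smult (f $$ (n - int i)) (coeff rB i)) -
      (if n < 0 then 0 else coeff rA (nat n))"
    have "R \<in> polys_over G"
      unfolding R_def using rA rB f
      by (intro polys_over_intros G) (auto intro: polys_over_0[OF G])
    moreover have "poly R y = (fls_of_poly (?ev rB) * f) $$ n - fls_of_poly (?ev rA) $$ n"
      unfolding fls_of_map_poly_times_nth[of "\<lambda>a. poly a y", OF poly_0]
      by (simp add: R_def poly_sum fls_of_poly_nth coeff_map_poly mult.commute)
    ultimately have "R = 0"
      using transcendental_poly_eq_0[OF G y] ev_eq by auto
    then have "coeff R j = 0" by simp
    moreover have "(fls_of_poly B' * f) $$ n = (\<Sum>i\<le>degree rB. coeff (coeff rB i) j * f $$ (n - int i))"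
      unfolding B'_def by (simp add: fls_of_map_poly_times_nth)
    ultimately show "(fls_of_poly B' * f) $$ n = fls_of_poly A' $$ n"
      by (simp add: R_def coeff_sum fls_of_poly_nth A'_def coeff_map_poly mult.commute
          split: if_splits)
  qed
  then have T': "expands G x (poly A' x / poly B' x) f"
    using AB' B'x by (intro expandsI[of A' _ B']) auto
  have "T = poly A' x / poly B' x"
    using expands_inj[OF M x T expands_mono[OF subset_adjoin T']] .
  then show ?thesis using expands_in_adjoin[OF G T'] by simp
qed

section \<open>Linear elements of a rational function field\<close>

lemma expansion_coeff_equation:
  assumes D: "derivation D" and L: "differential_subfield D L"
    and P: "P \<in> polys_over L" "D y = poly P y" and y: "\<not> algebraic_over L y"
    and g: "expands L y g f" "D g = a * g + b" and ab: "a \<in> L" "b \<in> L"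
  shows "D (f $$ n) + (\<Sum>i\<le>degree P. coeff P i * (of_int (n - int i + 1) * f $$ (n - int i + 1))) =
    a * f $$ n + (if n = 0 then b else 0)"
proof -
  have sL: "subfield L" and DL: "\<And>c. c \<in> L \<Longrightarrow> D c \<in> L"
    using L by (auto simp: differential_subfield_def)
  have "expands L y (a * g + b) (fls_const a * f + fls_const b)"
    by (intro expands_add expands_mult expands_const sL g ab)
  then have "fls_twisted_deriv D P f = fls_const a * f + fls_const b"
    using expands_unique[OF sL y expands_deriv[OF sL D DL P g(1)]] g(2) by simp
  then show ?thesis
    using fls_twisted_deriv_nth[OF D, of P f n] by simp
qed

text \<open>
  Since \<open>P\<close> is divisible by \<open>Y\<^sup>2\<close>, the term \<open>P f'\<close> in the derivative of a series \<open>f\<close> contributes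
  to the index \<open>n\<close> only through coefficients of index less than \<open>n\<close>.
\<close>

lemma lowest_coeff_equation:
  assumes D: "derivation D" and L: "differential_subfield D L"
    and P: "P \<in> polys_over L" "D y = poly P y" "coeff P 0 = 0" "coeff P 1 = 0"
    and y: "\<not> algebraic_over L y"
    and g: "expands L y g f" "D g = a * g + b" and ab: "a \<in> L" "b \<in> L"
    and low: "\<And>j. j < n \<Longrightarrow> f $$ j = 0"
  shows "D (f $$ n) = a * f $$ n + (if n = 0 then b else 0)"
proof -
  have 0: "coeff P i * (of_int (n - int i + 1) * f $$ (n - int i + 1)) = 0" for i
  proof -
    consider "i = 0" | "i = 1" | "n - int i + 1 < n" by linarith
    then show ?thesis using P low by cases auto
  qed
  then show ?thesis
    using expansion_coeff_equation[OF D L P(1,2) y g ab, of n] by (simp only: 0 sum.neutral_const add_0_right)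
qed

text \<open>
  If \<open>g\<close> had no pole at \<open>y = 0\<close>, its value there would solve the same equation as \<open>g\<close>; the
  difference, divided by its leading coefficient, would then be a new constant. So there is a pole,
  and dividing by the leading coefficient \<open>c\<close> removes the homogeneous part of the equation.
\<close>

lemma linear_element_normal_form:
  fixes D :: "'a::field_char_0 \<Rightarrow> 'a"
  assumes D: "derivation D" and L: "differential_subfield D L"
    and const: "\<And>x. D x = 0 \<Longrightarrow> x \<in> L"
    and P: "P \<in> polys_over L" "D y = poly P y" "coeff P 0 = 0" "coeff P 1 = 0"
    and y: "\<not> algebraic_over L y"
    and g: "g \<in> adjoin L {y}" "g \<notin> L" "D g = a * g + b" and ab: "a \<in> L" "b \<in> L"
  obtains c f m where "c \<in> L" "c \<noteq> 0" "D (g / c) = b / c" "g / c \<in> adjoin L {y}" "g / c \<notin> L"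
    "expands L y (g / c) f" "m < 0" "f $$ m = 1" "\<And>j. j < m \<Longrightarrow> f $$ j = 0"
proof -
  have sL: "subfield L" using L by (simp add: differential_subfield_def)
  obtain f where f: "expands L y g f" using expands_exists[OF sL g(1)] by blast
  have "f \<noteq> 0"
  proof
    assume "f = 0"
    moreover have "expands L y 0 0" using expands_const[OF sL subfield_0[OF sL], of y] by simp
    ultimately have "g = 0" using expands_inj[OF sL y] f by blast
    then show False using g(2) subfield_0[OF sL] by simp
  qed
  define m where "m = fls_subdegree f"
  have low: "f $$ j = 0" if "j < m" for j
    using that by (simp add: m_def fls_eq0_below_subdegree)
  show thesis
  proof (cases "m < 0")
    case True
    define c where "c = f $$ m"
    have c0: "c \<noteq> 0" using \<open>f \<noteq> 0\<close> by (simp add: c_def m_def)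
    have cL: "c \<in> L" unfolding c_def by (rule expands_coeff_in[OF sL f])
    have "D c = a * c"
      using lowest_coeff_equation[OF D L P y f g(3) ab, of m] low True by (simp add: c_def)
    then have Dh: "D (g / c) = b / c"
      using c0 g(3) by (simp add: deriv_divide[OF D])
    have "expands L y (inverse c * g) (fls_const (inverse c) * f)"
      by (intro expands_mult[OF sL] expands_const[OF sL] f subfield_inverse[OF sL] cL)
    then have exp: "expands L y (g / c) (fls_const (inverse c) * f)"
      by (simp add: divide_inverse mult.commute)
    have "g / c \<notin> L" using subfield_mult[OF sL cL, of "g / c"] g(2) c0 by auto
    then show thesis
      by (rule that[OF cL c0 Dh expands_in_adjoin[OF sL exp] _ exp True])
        (use low c0 in \<open>simp_all add: c_def\<close>)
  next
    case False
    define g\<^sub>1 where "g\<^sub>1 = g - f $$ 0"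
    define f\<^sub>1 where "f\<^sub>1 = f + fls_const (- (f $$ 0))"
    have f0L: "f $$ 0 \<in> L" by (rule expands_coeff_in[OF sL f])
    have "D (f $$ 0) = a * f $$ 0 + b"
      using lowest_coeff_equation[OF D L P y f g(3) ab, of 0] low False by simp
    then have Dg1: "D g\<^sub>1 = a * g\<^sub>1 + 0"
      by (simp add: g\<^sub>1_def deriv_diff[OF D] g(3) algebra_simps)
    have f1: "expands L y g\<^sub>1 f\<^sub>1"
      using expands_add[OF sL f expands_const[OF sL subfield_uminus[OF sL f0L]]]
      by (simp add: g\<^sub>1_def f\<^sub>1_def)
    have g1: "g\<^sub>1 \<notin> L" using subfield_add[OF sL _ f0L, of g\<^sub>1] g(2) by (auto simp: g\<^sub>1_def)
    have "f\<^sub>1 \<noteq> 0"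
    proof
      assume "f\<^sub>1 = 0"
      moreover have "expands L y 0 0" using expands_const[OF sL subfield_0[OF sL], of y] by simp
      ultimately have "g\<^sub>1 = 0" using expands_inj[OF sL y] f1 by blast
      then show False using g1 subfield_0[OF sL] by simp
    qed
    define c where "c = f\<^sub>1 $$ fls_subdegree f\<^sub>1"
    have c0: "c \<noteq> 0" using \<open>f\<^sub>1 \<noteq> 0\<close> by (simp add: c_def)
    have cL: "c \<in> L" unfolding c_def by (rule expands_coeff_in[OF sL f1])
    have "D c = a * c"
      unfolding c_def
      using lowest_coeff_equation[OF D L P y f1 Dg1 ab(1) subfield_0[OF sL], of "fls_subdegree f\<^sub>1"]
      by (simp add: fls_eq0_below_subdegree)
    then have "D (g\<^sub>1 / c) = 0" using deriv_divide_exponentials[OF D] Dg1 by simp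
    then have "c * (g\<^sub>1 / c) \<in> L" using const subfield_mult[OF sL cL] by blast
    then show thesis using g1 c0 by simp
  qed
qed

text \<open>
  The property that is carried down the tower. The homogeneous part \<open>a * g\<close> is admitted because
  descending through an exponential generator creates one.
\<close>

definition linear_element :: "('a::field \<Rightarrow> 'a) \<Rightarrow> 'a set \<Rightarrow> 'a \<Rightarrow> bool" where
  "linear_element D L y \<longleftrightarrow>
     (\<exists>g\<in>adjoin L {y} - L. \<exists>a\<in>L. \<exists>b\<in>L. D g = a * g + b)"

lemma linear_elementI:
  "g \<in> adjoin L {y} \<Longrightarrow> g \<notin> L \<Longrightarrow> a \<in> L \<Longrightarrow> b \<in> L \<Longrightarrow> D g = a * g + b \<Longrightarrow> linear_element D L y"
  unfolding linear_element_def by blast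

section \<open>Descent along the tower\<close>

context
  fixes D :: "'a::field_char_0 \<Rightarrow> 'a" and G :: "'a set" and P :: "'a poly" and y :: 'a
  assumes D: "derivation D" and G: "differential_subfield D G"
    and const: "\<And>x. D x = 0 \<Longrightarrow> x \<in> G"
    and P: "P \<in> polys_over G" "D y = poly P y"
begin

lemma subfield_G: "subfield G"
  using G by (simp add: differential_subfield_def)

lemma differential_subfield_adjoin_y: "differential_subfield D (adjoin G {y})"
  using poly_in_adjoin[OF P(1), of y] P(2) by (intro differential_subfield_adjoin[OF D G]) simp

text \<open>
  By the exchange property \<open>t\<close> is algebraic over \<open>G(y)\<close>. If \<open>t\<close> is a primitive, its normalised trace
  has the same derivative and so differs from \<open>t\<close> by a constant. If \<open>t\<close> is an exponential, the
  traces of the powers of \<open>t\<close> cannot all vanish, since the minimal polynomial has a constant term;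
  a nonzero one is a constant multiple of the power. In both cases \<open>t\<close> would be algebraic over \<open>G\<close>
  if the trace were in \<open>G\<close>.
\<close>

lemma linear_element_base:
  assumes y: "\<not> algebraic_over G y" and t: "\<not> algebraic_over G t"
    and Dt: "D t \<in> G \<or> D t / t \<in> G" and yt: "algebraic_over (adjoin G {t}) y"
  shows "linear_element D G y"
proof -
  let ?M = "adjoin G {y}" and ?N = "adjoin (adjoin G {y}) {t}"
  note sG = subfield_G and sM = subfield_adjoin[of G "{y}"] and sN = subfield_adjoin[of ?M "{t}"]
  have GM: "x \<in> ?M" if "x \<in> G" for x using that subset_adjoin by blast
  have MN: "x \<in> ?N" if "x \<in> ?M" for x using that subset_adjoin[of ?M] by blast
  have t0: "t \<noteq> 0" using t algebraic_over_element[OF sG subfield_0[OF sG]] by auto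
  have tM: "algebraic_over ?M t" using algebraic_exchange[OF sG yt] y by blast
  have tN: "t ^ j \<in> ?N" for j by (rule subfield_power[OF sN generator_in_adjoin])
  have "D t \<in> ?N"
  proof -
    have "D t = D t / t * t" using t0 by simp
    then show ?thesis using Dt GM MN subfield_mult[OF sN _ generator_in_adjoin] by metis
  qed
  then have N: "differential_subfield D ?N"
    by (rule differential_subfield_adjoin[OF D differential_subfield_adjoin_y])
  obtain \<tau> where \<tau>M: "\<And>x. x \<in> ?N \<Longrightarrow> \<tau> x \<in> ?M"
    and \<tau>add: "\<And>x z. x \<in> ?N \<Longrightarrow> z \<in> ?N \<Longrightarrow> \<tau> (x + z) = \<tau> x + \<tau> z"
    and \<tau>scale: "\<And>c x. c \<in> ?M \<Longrightarrow> x \<in> ?N \<Longrightarrow> \<tau> (c * x) = c * \<tau> x"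
    and \<tau>1: "\<tau> 1 = 1" and \<tau>D: "\<And>x. x \<in> ?N \<Longrightarrow> \<tau> (D x) = D (\<tau> x)"
    using normalised_trace_exists[OF D differential_subfield_adjoin_y tM N] by blast
  have \<tau>c: "\<tau> c = c" if "c \<in> ?M" for c
    using \<tau>scale[OF that subfield_1[OF sN]] \<tau>1 by simp
  from Dt show ?thesis
  proof
    assume b: "D t \<in> G"
    have T: "\<tau> t \<in> ?M" by (rule \<tau>M[OF generator_in_adjoin])
    have DT: "D (\<tau> t) = D t" using \<tau>D[OF generator_in_adjoin] \<tau>c[OF GM[OF b]] by simp
    then have "\<tau> t - t \<in> G" by (intro const) (simp add: deriv_diff[OF D])
    then have "\<tau> t \<notin> G"
      using t algebraic_over_element[OF sG] subfield_diff[OF sG, of "\<tau> t" "\<tau> t - t"] by auto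
    then show ?thesis
      by (rule linear_elementI[OF T _ subfield_0[OF sG] b]) (simp add: DT)
  next
    assume a: "D t / t \<in> G"
    obtain q where q: "is_min_poly ?M t q" using min_poly_exists[OF sM tM] .
    have qM: "coeff q i \<in> ?M" for i using q by (auto simp: is_min_poly_def polys_over_def)
    have "\<exists>j>0. \<tau> (t ^ j) \<noteq> 0"
    proof (rule ccontr)
      assume "\<not> (\<exists>j>0. \<tau> (t ^ j) \<noteq> 0)"
      then have 0: "\<tau> (t ^ j) = 0" if "j > 0" for j using that by blast
      have "\<tau> (\<Sum>i\<in>I. coeff q i * t ^ i) = (\<Sum>i\<in>I. coeff q i * \<tau> (t ^ i))" if "finite I" for I
        using that
      proof (induction I rule: finite_induct)
        case empty
        then show ?case using \<tau>c[OF subfield_0[OF sM]] by simp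
      next
        case (insert i I)
        have "(\<Sum>i\<in>I. coeff q i * t ^ i) \<in> ?N"
          by (intro subfield_sum[OF sN] subfield_mult[OF sN] MN qM tN)
        then show ?case
          using insert by (simp add: \<tau>add \<tau>scale qM tN subfield_mult[OF sN MN[OF qM] tN])
      qed
      then have "\<tau> (poly q t) = (\<Sum>i\<le>degree q. coeff q i * \<tau> (t ^ i))"
        unfolding poly_altdef by simp
      also have "\<dots> = coeff q 0 * \<tau> (t ^ 0)"
        by (subst sum.remove[of _ 0]) (auto intro!: sum.neutral simp: 0)
      finally have "coeff q 0 = 0"
        using q \<tau>c[OF subfield_0[OF sM]] \<tau>1 by (simp add: is_min_poly_def)
      then obtain r where r: "q = pCons 0 r" by (metis coeff_pCons_0 pCons_cases)
      have "poly r t = 0" using q t0 r by (simp add: is_min_poly_def)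
      moreover have "r \<in> polys_over ?M" using qM r by (metis coeff_pCons_Suc polys_overI)
      moreover have "r \<noteq> 0" using q r by (auto simp: is_min_poly_def)
      moreover from this have "degree r < degree q" using r by simp
      ultimately show False using q by (auto simp: is_min_poly_def)
    qed
    then obtain j where j: "j > 0" "\<tau> (t ^ j) \<noteq> 0" by blast
    define e where "e = of_nat j * (D t / t)"
    have eG: "e \<in> G" unfolding e_def by (intro subfield_mult[OF sG] subfield_of_nat[OF sG] a)
    have Dtj: "D (t ^ j) = e * t ^ j"
      unfolding e_def by (rule deriv_power_exponential[OF D]) (use t0 in simp)
    have T: "\<tau> (t ^ j) \<in> ?M" by (rule \<tau>M[OF tN])
    have DT: "D (\<tau> (t ^ j)) = e * \<tau> (t ^ j)"
      using \<tau>D[OF tN, of j] \<tau>scale[OF GM[OF eG] tN] Dtj by simp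
    have c: "\<tau> (t ^ j) / t ^ j \<in> G"
      using const deriv_divide_exponentials[OF D DT Dtj] by blast
    have "\<tau> (t ^ j) \<notin> G"
    proof
      assume "\<tau> (t ^ j) \<in> G"
      then have "\<tau> (t ^ j) / (\<tau> (t ^ j) / t ^ j) \<in> G" using c by (rule subfield_divide[OF sG])
      then have tj: "t ^ j \<in> G" using j by simp
      define p where "p = monom 1 j - [:t ^ j:]"
      have "p \<in> polys_over G"
        unfolding p_def using tj by (intro polys_over_intros sG subfield_1[OF sG])
      moreover have "coeff p j = 1" using j(1) by (cases j) (auto simp: p_def coeff_pCons)
      then have "p \<noteq> 0" by auto
      moreover have "poly p t = 0" by (simp add: p_def poly_monom)
      ultimately show False using t algebraic_over_iff[OF sG] by blast
    qed
    then show ?thesis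
      by (rule linear_elementI[OF T _ eG subfield_0[OF sG]]) (simp add: DT)
  qed
qed

text \<open>
  Expand an element \<open>h\<close> of \<open>G(\<sigma>)(y)\<close> with derivative in \<open>G(\<sigma>)\<close> as a Laurent series in \<open>\<sigma>\<close> over
  \<open>G(y)\<close>. The derivative of \<open>h\<close> has coefficients in \<open>G\<close>, and its coefficient of index \<open>n\<close> involves
  those of \<open>h\<close> up to index \<open>n\<close> only, because \<open>D \<sigma>\<close> has no constant term. Hence the first
  coefficient of \<open>h\<close> outside \<open>G\<close> satisfies a linear equation over \<open>G\<close>.
\<close>

lemma linear_element_descent_parameter:
  assumes P01: "coeff P 0 = 0" "coeff P 1 = 0"
    and s: "\<not> algebraic_over G \<sigma>" and Ds: "D \<sigma> = e\<^sub>1 * \<sigma> + e\<^sub>2 * \<sigma>\<^sup>2" "e\<^sub>1 \<in> G" "e\<^sub>2 \<in> G"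
    and y: "\<not> algebraic_over (adjoin G {\<sigma>}) y"
    and lin: "linear_element D (adjoin G {\<sigma>}) y"
  shows "linear_element D G y"
proof -
  let ?F = "adjoin G {\<sigma>}" and ?M = "adjoin G {y}"
  note sG = subfield_G and sM = subfield_adjoin[of G "{y}"] and sF = subfield_adjoin[of G "{\<sigma>}"]
  have GF: "G \<subseteq> ?F" and GM: "G \<subseteq> ?M" by (rule subset_adjoin)+
  have yG: "\<not> algebraic_over G y" using y algebraic_over_mono[OF GF] by blast
  have "D \<sigma> \<in> ?F"
    unfolding Ds using Ds(2,3) GF generator_in_adjoin[of \<sigma> G]
    by (intro subfield_add[OF sF] subfield_mult[OF sF] subfield_power[OF sF]) auto
  then have F: "differential_subfield D ?F" by (rule differential_subfield_adjoin[OF D G])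
  have constF: "D x = 0 \<Longrightarrow> x \<in> ?F" for x using const GF by blast
  have PF: "P \<in> polys_over ?F" using P(1) polys_over_mono[OF GF] by blast
  obtain g a b where g: "g \<in> adjoin ?F {y}" "g \<notin> ?F" "D g = a * g + b" "a \<in> ?F" "b \<in> ?F"
    using lin unfolding linear_element_def by blast
  obtain c where c: "c \<in> ?F" "D (g / c) = b / c" "g / c \<in> adjoin ?F {y}" "g / c \<notin> ?F"
    using linear_element_normal_form[OF D F constF PF P(2) P01 y g] by metis
  define h where "h = g / c"
  define d where "d = b / c"
  have Dh: "D h = d" and dF: "d \<in> ?F" and hF: "h \<notin> ?F"
    using c g(5) by (auto simp: h_def d_def intro: subfield_divide[OF sF])
  have "adjoin ?F {y} \<subseteq> adjoin ?M {\<sigma>}"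
  proof (rule adjoin_least[OF subfield_adjoin])
    show "?F \<subseteq> adjoin ?M {\<sigma>}" by (rule adjoin_mono[OF GM])
    show "{y} \<subseteq> adjoin ?M {\<sigma>}" using generator_in_adjoin[of y G] subset_adjoin[of ?M] by blast
  qed
  then have hM: "h \<in> adjoin ?M {\<sigma>}" using c(3) unfolding h_def by blast
  have sM': "\<not> algebraic_over ?M \<sigma>" using algebraic_exchange[OF sG] s y by blast
  obtain f where f: "expands ?M \<sigma> h f" using expands_exists[OF sM hM] by blast
  obtain f' where f': "expands G \<sigma> d f'" using expands_exists[OF sG dF] by blast
  define Q where "Q = [:0, e\<^sub>1, e\<^sub>2:]"
  have Q: "Q \<in> polys_over ?M" "D \<sigma> = poly Q \<sigma>"
    using Ds GM sM by (auto simp: Q_def power2_eq_square algebra_simps intro!: polys_over_intros subfield_0)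
  have "expands ?M \<sigma> (D h) (fls_twisted_deriv D Q f)"
    using differential_subfield_adjoin_y
    by (intro expands_deriv[OF sM D _ Q f]) (auto simp: differential_subfield_def)
  then have eq: "fls_twisted_deriv D Q f = f'"
    using expands_unique[OF sM sM' _ expands_mono[OF GM f']] Dh by simp
  have coeff: "D (f $$ n) + (e\<^sub>1 * of_int n * f $$ n + e\<^sub>2 * of_int (n - 1) * f $$ (n - 1)) = f' $$ n" for n
  proof -
    have "(\<Sum>i\<le>degree Q. coeff Q i * (of_int (n - int i + 1) * f $$ (n - int i + 1))) =
        (\<Sum>i\<le>2. coeff Q i * (of_int (n - int i + 1) * f $$ (n - int i + 1)))"
      by (rule sum.mono_neutral_left) (auto simp: Q_def coeff_eq_0)
    also have "\<dots> = e\<^sub>1 * of_int n * f $$ n + e\<^sub>2 * of_int (n - 1) * f $$ (n - 1)"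
      by (simp add: Q_def numeral_2_eq_2)
    finally show ?thesis using fls_twisted_deriv_nth[OF D, of Q f n] eq by simp
  qed
  \<comment> \<open>Otherwise \<open>h\<close> would be a rational function of \<open>\<sigma>\<close> over \<open>G\<close>.\<close>
  have "\<exists>n. f $$ n \<notin> G"
    using rational_over_coefficient_field[OF sG yG sM' f] hF by blast
  then obtain n0 where n0: "f $$ n0 \<notin> G" by blast
  have ge: "n \<ge> fls_subdegree f" if "f $$ n \<notin> G" for n
    using that subfield_0[OF sG] by (metis fls_eq0_below_subdegree not_le)
  define k where "k = (LEAST k. f $$ (fls_subdegree f + int k) \<notin> G)"
  have "f $$ (fls_subdegree f + int (nat (n0 - fls_subdegree f))) \<notin> G"
    using n0 ge[OF n0] by simp
  then have k: "f $$ (fls_subdegree f + int k) \<notin> G" unfolding k_def by (rule LeastI)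
  define n where "n = fls_subdegree f + int k"
  have prev: "f $$ (n - 1) \<in> G"
  proof (rule ccontr)
    assume 1: "f $$ (n - 1) \<notin> G"
    from ge[OF this] have k1: "k - 1 < k" "n - 1 = fls_subdegree f + int (k - 1)"
      by (auto simp: n_def)
    have "f $$ (fls_subdegree f + int (k - 1)) \<in> G"
      using not_less_Least[OF k1(1)[unfolded k_def]] by (simp add: k_def)
    then show False using 1 k1(2) by simp
  qed
  show ?thesis
  proof (rule linear_elementI)
    show "f $$ n \<in> ?M" by (rule expands_coeff_in[OF sM f])
    show "f $$ n \<notin> G" using k by (simp add: n_def)
    show "- (e\<^sub>1 * of_int n) \<in> G"
      by (intro subfield_uminus subfield_mult subfield_of_int sG Ds)
    show "f' $$ n - e\<^sub>2 * of_int (n - 1) * f $$ (n - 1) \<in> G"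
      by (intro subfield_diff subfield_mult subfield_of_int sG Ds prev expands_coeff_in[OF sG f'])
    show "D (f $$ n) = - (e\<^sub>1 * of_int n) * f $$ n + (f' $$ n - e\<^sub>2 * of_int (n - 1) * f $$ (n - 1))"
      using coeff[of n] by (simp add: algebra_simps)
  qed
qed

lemma linear_element_descent_transcendental:
  assumes P01: "coeff P 0 = 0" "coeff P 1 = 0"
    and t: "\<not> algebraic_over G t" and Dt: "D t \<in> G \<or> D t / t \<in> G"
    and y: "\<not> algebraic_over (adjoin G {t}) y" and lin: "linear_element D (adjoin G {t}) y"
  shows "linear_element D G y"
proof -
  note sG = subfield_G
  have t0: "t \<noteq> 0" using t algebraic_over_element[OF sG subfield_0[OF sG]] by auto
  from Dt show ?thesis
  proof
    assume a: "D t / t \<in> G"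
    show ?thesis
    proof (rule linear_element_descent_parameter[OF P01 t _ a subfield_0[OF sG] y lin])
      show "D t = D t / t * t + 0 * t\<^sup>2" using t0 by simp
    qed
  next
    assume b: "D t \<in> G"
    \<comment> \<open>The derivative \<open>- D t * \<sigma>\<^sup>2\<close> of \<open>\<sigma> = 1 / t\<close> has no constant term, unlike that of \<open>t\<close>.\<close>
    let ?\<sigma> = "inverse t"
    have inv: "inverse x \<in> adjoin G {x}" for x
      by (rule subfield_inverse[OF subfield_adjoin generator_in_adjoin])
    have "adjoin G {?\<sigma>} \<subseteq> adjoin G {t}" "adjoin G {t} \<subseteq> adjoin G {?\<sigma>}"
      by (rule adjoin_least[OF subfield_adjoin subset_adjoin], use inv[of t] inv[of ?\<sigma>] in simp)+
    then have F: "adjoin G {?\<sigma>} = adjoin G {t}" by blast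
    have "\<not> algebraic_over G ?\<sigma>"
    proof
      assume "algebraic_over G ?\<sigma>"
      moreover have "algebraic_over (adjoin G {?\<sigma>}) t"
        using F generator_in_adjoin by (intro algebraic_over_element subfield_adjoin) auto
      ultimately show False using algebraic_over_trans[OF sG] t by blast
    qed
    then show ?thesis
    proof (rule linear_element_descent_parameter[OF P01 _ _ subfield_0[OF sG] _ y[folded F] lin[folded F]])
      show "- D t \<in> G" using b by (rule subfield_uminus[OF sG])
      show "D ?\<sigma> = 0 * ?\<sigma> + - D t * ?\<sigma>\<^sup>2"
        using t0 deriv_divide[OF D t0, of 1]
        by (simp add: deriv_1[OF D] inverse_eq_divide power2_eq_square)
    qed
  qed
qed

text \<open>
  The trace from \<open>G(s)\<close> to \<open>G\<close>, applied to the Laurent coefficients in \<open>y\<close>, maps a rational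
  function with denominator over \<open>G\<close> to one over \<open>G\<close>. It keeps the leading coefficient \<open>1\<close> of a
  normalised element, so that the result has a pole at \<open>y = 0\<close> again.
\<close>

lemma linear_element_descent_algebraic:
  assumes P01: "coeff P 0 = 0" "coeff P 1 = 0"
    and s: "algebraic_over G s" and F: "differential_subfield D (adjoin G {s})"
    and y: "\<not> algebraic_over (adjoin G {s}) y" and lin: "linear_element D (adjoin G {s}) y"
  shows "linear_element D G y"
proof -
  let ?F = "adjoin G {s}" and ?M = "adjoin G {y}"
  note sG = subfield_G and sM = subfield_adjoin[of G "{y}"] and sF = subfield_adjoin[of G "{s}"]
  have GF: "G \<subseteq> ?F" and GM: "G \<subseteq> ?M" by (rule subset_adjoin)+
  have yG: "\<not> algebraic_over G y" using y algebraic_over_mono[OF GF] by blast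
  have constF: "D x = 0 \<Longrightarrow> x \<in> ?F" for x using const GF by blast
  have PF: "P \<in> polys_over ?F" using P(1) polys_over_mono[OF GF] by blast
  obtain g a b where g: "g \<in> adjoin ?F {y}" "g \<notin> ?F" "D g = a * g + b" "a \<in> ?F" "b \<in> ?F"
    using lin unfolding linear_element_def by blast
  obtain c f m where c: "c \<in> ?F" "D (g / c) = b / c" "g / c \<in> adjoin ?F {y}" "g / c \<notin> ?F"
    and f: "expands ?F y (g / c) f" and m: "m < 0" "f $$ m = 1"
    using linear_element_normal_form[OF D F constF PF P(2) P01 y g] by metis
  define h where "h = g / c"
  define d where "d = b / c"
  have Dh: "D h = d" and dF: "d \<in> ?F"
    using c g(5) by (auto simp: h_def d_def intro: subfield_divide[OF sF])
  have fF: "f $$ n \<in> ?F" for n by (rule expands_coeff_in[OF sF f])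
  have f_eq: "D (f $$ n) + (\<Sum>i\<le>degree P. coeff P i * (of_int (n - int i + 1) * f $$ (n - int i + 1))) =
      (if n = 0 then d else 0)" for n
    using expansion_coeff_equation[OF D F PF P(2) y f, of 0 d n] Dh dF subfield_0[OF sF]
    by (simp add: h_def)

  \<comment> \<open>\<open>h\<close> is a fraction with denominator \<open>B\<close> over \<open>G\<close>.\<close>
  have "adjoin ?F {y} \<subseteq> adjoin ?M {s}"
  proof (rule adjoin_least[OF subfield_adjoin])
    show "?F \<subseteq> adjoin ?M {s}" by (rule adjoin_mono[OF GM])
    show "{y} \<subseteq> adjoin ?M {s}" using generator_in_adjoin[of y G] subset_adjoin[of ?M] by blast
  qed
  then have hM: "h \<in> adjoin ?M {s}" using c(3) unfolding h_def by blast
  obtain q where q: "is_min_poly ?M s q"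
    using min_poly_exists[OF sM algebraic_over_mono[OF GM s]] .
  obtain p where p: "p \<in> polys_over ?M" "h = poly p s"
    using hM adjoin_algebraic_iff[OF sM q] by blast
  obtain B r where B: "B \<in> polys_over G" "r \<in> polys_over (polys_over G)" "poly B y \<noteq> 0"
    "smult (poly B y) p = map_poly (\<lambda>a. poly a y) r"
    using common_denominator[OF sG p(1)] by blast
  define A where "A = poly r [:s:]"
  have A: "A \<in> polys_over ?F"
    unfolding A_def using B(2) polys_over_mono[OF polys_over_mono[OF GF]]
    by (intro poly_bivariate_in_polys_over sF generator_in_adjoin) blast
  have hAB: "poly B y * h = poly A y"
    unfolding A_def poly_poly_const B(4)[symmetric] p(2) by simp
  have BF: "B \<in> polys_over ?F" using B(1) polys_over_mono[OF GF] by blast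
  have "fls_of_poly B \<noteq> 0" using B(3) by (auto simp: fls_of_poly_eq_0_iff)
  then have "expands ?F y h (fls_of_poly A / fls_of_poly B)"
    using A BF B(3) hAB by (intro expandsI[of A _ B]) auto
  then have "f = fls_of_poly A / fls_of_poly B"
    using expands_unique[OF sF y] f unfolding h_def by blast
  then have fAB: "fls_of_poly B * f = fls_of_poly A" using \<open>fls_of_poly B \<noteq> 0\<close> by simp

  obtain \<tau> where \<tau>G: "\<And>x. x \<in> ?F \<Longrightarrow> \<tau> x \<in> G"
    and \<tau>add: "\<And>x z. x \<in> ?F \<Longrightarrow> z \<in> ?F \<Longrightarrow> \<tau> (x + z) = \<tau> x + \<tau> z"
    and \<tau>scale: "\<And>c x. c \<in> G \<Longrightarrow> x \<in> ?F \<Longrightarrow> \<tau> (c * x) = c * \<tau> x"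
    and \<tau>1: "\<tau> 1 = 1" and \<tau>D: "\<And>x. x \<in> ?F \<Longrightarrow> \<tau> (D x) = D (\<tau> x)"
    using normalised_trace_exists[OF D G s F] by blast
  have \<tau>0: "\<tau> 0 = 0" using \<tau>scale[OF subfield_0[OF sG] subfield_1[OF sF]] by simp
  have \<tau>comb: "\<tau> (\<Sum>i\<in>I. e i * x i) = (\<Sum>i\<in>I. e i * \<tau> (x i))"
    if "finite I" "\<And>i. e i \<in> G" "\<And>i. x i \<in> ?F" for I and e x :: "nat \<Rightarrow> 'a"
    using that(1)
  proof (induction I rule: finite_induct)
    case (insert i I)
    have "e j * x j \<in> ?F" for j using that GF by (intro subfield_mult[OF sF]) auto
    then show ?case using insert that by (simp add: \<tau>add \<tau>scale subfield_sum[OF sF])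
  qed (simp add: \<tau>0)

  \<comment> \<open>Since \<open>B\<close> has coefficients in \<open>G\<close>, the relation \<open>B f = A\<close> survives the application of \<open>\<tau>\<close>.\<close>
  define f\<^sub>0 where "f\<^sub>0 = fls_map \<tau> f"
  define A\<^sub>0 where "A\<^sub>0 = map_poly \<tau> A"
  define h\<^sub>0 where "h\<^sub>0 = poly A\<^sub>0 y / poly B y"
  have f0: "f\<^sub>0 $$ n = \<tau> (f $$ n)" for n by (simp add: f\<^sub>0_def fls_map_nth[of \<tau>, OF \<tau>0])
  have "fls_of_poly B * f\<^sub>0 = fls_of_poly A\<^sub>0"
  proof (rule fls_eqI)
    fix n
    have "(fls_of_poly B * f\<^sub>0) $$ n = \<tau> ((fls_of_poly B * f) $$ n)"
      unfolding fls_of_poly_times_nth f0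
      by (rule \<tau>comb[symmetric]) (use B(1) fF in \<open>auto dest: polys_overD\<close>)
    also have "\<dots> = fls_of_poly A\<^sub>0 $$ n"
      unfolding fAB by (simp add: fls_of_poly_nth A\<^sub>0_def coeff_map_poly \<tau>0)
    finally show "(fls_of_poly B * f\<^sub>0) $$ n = fls_of_poly A\<^sub>0 $$ n" .
  qed
  moreover have A0: "A\<^sub>0 \<in> polys_over G"
    using A by (auto simp: polys_over_def A\<^sub>0_def coeff_map_poly \<tau>0 intro: \<tau>G)
  ultimately have h0: "expands G y h\<^sub>0 f\<^sub>0"
    using B(1,3) by (intro expandsI[of A\<^sub>0 _ B]) (auto simp: h\<^sub>0_def)
  have "fls_twisted_deriv D P f\<^sub>0 = fls_const (\<tau> d)"
  proof (rule fls_eqI)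
    fix n
    define e where "e i = coeff P i * of_int (n - int i + 1)" for i
    let ?S = "\<lambda>u. \<Sum>i\<le>degree P. e i * u (n - int i + 1)"
    have eG: "e i \<in> G" for i
      unfolding e_def using P(1)
      by (intro subfield_mult[OF sG] subfield_of_int[OF sG]) (auto dest: polys_overD)
    have "fls_twisted_deriv D P f\<^sub>0 $$ n = D (f\<^sub>0 $$ n) + ?S (($$) f\<^sub>0)"
      by (simp only: fls_twisted_deriv_nth[OF D] e_def mult.assoc)
    also have "\<dots> = \<tau> (D (f $$ n)) + \<tau> (?S (($$) f))"
      unfolding f0 by (subst \<tau>comb) (use eG fF in \<open>auto simp: \<tau>D\<close>)
    also have "\<dots> = \<tau> (D (f $$ n) + ?S (($$) f))"
    proof (rule \<tau>add[symmetric])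
      show "D (f $$ n) \<in> ?F" using F fF by (auto simp: differential_subfield_def)
      show "?S (($$) f) \<in> ?F"
        using eG GF by (intro subfield_sum[OF sF] subfield_mult[OF sF] fF) auto
    qed
    also have "D (f $$ n) + ?S (($$) f) = (if n = 0 then d else 0)"
      using f_eq[of n] by (simp only: e_def mult.assoc)
    finally show "fls_twisted_deriv D P f\<^sub>0 $$ n = fls_const (\<tau> d) $$ n" by (simp add: \<tau>0)
  qed
  then have "expands G y (D h\<^sub>0) (fls_const (\<tau> d))"
    using expands_deriv[OF sG D _ P h0] G by (auto simp: differential_subfield_def)
  then have Dh0: "D h\<^sub>0 = \<tau> d"
    using expands_inj[OF sG yG _ expands_const[OF sG \<tau>G[OF dF]]] by blast
  have "h\<^sub>0 \<notin> G"
  proof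
    assume "h\<^sub>0 \<in> G"
    then have "f\<^sub>0 = fls_const h\<^sub>0" using expands_unique[OF sG yG h0 expands_const[OF sG]] by blast
    then have "f\<^sub>0 $$ m = 0" using m by simp
    then show False using m \<tau>1 by (simp add: f0)
  qed
  then show ?thesis
    using Dh0 by (intro linear_elementI[OF expands_in_adjoin[OF sG h0] _ subfield_0[OF sG] \<tau>G[OF dF]]) auto
qed

end

text \<open>A root in \<open>L\<close> splits off a linear factor, so a minimal polynomial over \<open>L\<close> is linear.\<close>

lemma algebraic_over_algebraically_closed:
  assumes closed: "is_algebraic_closure K L" and x: "algebraic_over L x"
  shows "x \<in> L"
proof -
  have L: "subfield L" using closed by (simp add: is_algebraic_closure_def)
  obtain q where q: "is_min_poly L x q" using min_poly_exists[OF L x] .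
  have qL: "q \<in> polys_over L" "q \<noteq> 0" "poly q x = 0" using q by (auto simp: is_min_poly_def)
  obtain z where z: "z \<in> L" "poly q z = 0"
    using closed qL(1) min_poly_degree_pos[OF q]
    unfolding is_algebraic_closure_def set_coeffs_subset_iff[OF L] by blast
  have lin: "[:- z, 1:] \<in> polys_over L"
    using z(1) by (intro polys_over_intros L subfield_intros[OF L])
  have nz: "[:- z, 1:] \<noteq> 0" by simp
  obtain h r where hr: "h \<in> polys_over L" "q = [:- z, 1:] * h + r"
    "r = 0 \<or> degree r < degree [:- z, 1:]"
    using polys_over_division[OF L lin nz qL(1)] by metis
  have "degree r = 0" using hr(3) by auto
  then obtain c where c: "r = [:c:]" by (rule degree_eq_zeroE)
  have "c = 0" using z(2) hr(2) c by simp
  then have q_eq: "q = [:- z, 1:] * h" using hr(2) c by simp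
  then have "h \<noteq> 0" using qL(2) by auto
  moreover have "degree h < degree q"
    unfolding q_eq using \<open>h \<noteq> 0\<close> by (subst degree_mult_eq) auto
  ultimately have "poly h x \<noteq> 0" using q hr(1) by (auto simp: is_min_poly_def)
  then have "x = z" using q_eq qL(3) by simp
  then show ?thesis using z(1) by simp
qed

lemma linear_element_exists:
  fixes D :: "'a::field_char_0 \<Rightarrow> 'a"
  assumes D: "derivation D" and L: "liouvillian_extension D L UNIV"
    and const: "\<And>x. D x = 0 \<Longrightarrow> x \<in> L"
    and P: "P \<in> polys_over L" "D y = poly P y" "coeff P 0 = 0" "coeff P 1 = 0"
    and y: "\<not> algebraic_over L y"
  shows "linear_element D L y"
proof -
  obtain m and t :: "nat \<Rightarrow> 'a" and k :: "nat \<Rightarrow> 'a set"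
    where T: "UNIV = adjoin L (t ` {1..m}) \<and> k 0 = L \<and> k m = UNIV \<and>
        (\<forall>i\<le>m. differential_subfield D (k i)) \<and>
        (\<forall>i\<in>{1..m}. k i = adjoin (k (i - 1)) {t i} \<and>
           (D (t i) \<in> k (i - 1) \<or> (t i \<noteq> 0 \<and> D (t i) / t i \<in> k (i - 1)) \<or>
            algebraic_over (k (i - 1)) (t i)))"
    using L unfolding liouvillian_extension_def by (elim exE) (rule that, assumption)
  have km: "k 0 = L" "k m = UNIV" and diff: "\<And>i. i \<le> m \<Longrightarrow> differential_subfield D (k i)"
    using T by simp_all
  have tower: "k i = adjoin (k (i - 1)) {t i} \<and>
      (D (t i) \<in> k (i - 1) \<or> D (t i) / t i \<in> k (i - 1) \<or> algebraic_over (k (i - 1)) (t i))"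
    if "i \<in> {1..m}" for i
    using T that by blast
  have Lk: "L \<subseteq> k i" if "i \<le> m" for i
    using that
  proof (induction i)
    case (Suc i)
    then show ?case using tower[of "Suc i"] subset_adjoin[of "k i"] by auto
  qed (simp add: km)
  have "algebraic_over (k i) y \<or> linear_element D (k i) y" if "i \<le> m" for i
    using that
  proof (induction rule: inc_induct)
    case base
    have "subfield (k m)" using diff[of m] by (simp add: differential_subfield_def)
    then show ?case using km(2) algebraic_over_element by blast
  next
    case (step i)
    have i: "Suc i \<in> {1..m}" "i \<le> m" using step.hyps by auto
    let ?G = "k i" and ?t = "t (Suc i)"
    have F: "k (Suc i) = adjoin ?G {?t}"
      and cases: "D ?t \<in> ?G \<or> D ?t / ?t \<in> ?G \<or> algebraic_over ?G ?t"
      using tower[OF i(1)] by auto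
    have G: "differential_subfield D ?G" by (rule diff[OF i(2)])
    have constG: "D x = 0 \<Longrightarrow> x \<in> ?G" for x using const Lk[OF i(2)] by blast
    have PG: "P \<in> polys_over ?G" using P(1) polys_over_mono[OF Lk[OF i(2)]] by blast
    have sG: "subfield ?G" using G by (simp add: differential_subfield_def)
    show ?case
    proof (cases "algebraic_over ?G y")
      case False
      have "linear_element D ?G y"
      proof (cases "algebraic_over ?G ?t")
        case True
        have yF: "\<not> algebraic_over (adjoin ?G {?t}) y"
          using algebraic_over_trans[OF sG True] False by blast
        show ?thesis
          using linear_element_descent_algebraic[OF D G constG PG P(2-4) True _ yF]
            diff[of "Suc i"] i step.IH yF unfolding F by auto
      next
        case t: False
        have Dt: "D ?t \<in> ?G \<or> D ?t / ?t \<in> ?G" using cases t by blast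
        show ?thesis
        proof (cases "algebraic_over (adjoin ?G {?t}) y")
          case True
          then show ?thesis
            using linear_element_base[OF D G constG PG P(2) False t Dt] by blast
        next
          case yF: False
          then show ?thesis
            using linear_element_descent_transcendental[OF D G constG PG P(2-4) t Dt yF]
              step.IH unfolding F by blast
        qed
      qed
      then show ?thesis ..
    qed simp
  qed
  then show ?thesis using km(1) y by (metis le0)
qed

section \<open>Polynomial equations without constant term\<close>

text \<open>
  Dividing \<open>y\<close> by a solution of the linear part of its equation removes the linear part.
\<close>

lemma rescaled_equation:
  assumes D: "derivation D" and y: "D y = (\<Sum>i=1..n. \<alpha> i * y ^ i)"
    and \<gamma>: "\<gamma> \<noteq> 0" "D \<gamma> = \<alpha> 1 * \<gamma>" and n: "n \<ge> 1"
  shows "D (y / \<gamma>) = poly (\<Sum>i=2..n. monom (\<alpha> i * \<gamma> ^ (i - 1)) i) (y / \<gamma>)"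
proof -
  have "D (y / \<gamma>) = (\<Sum>i=1..n. \<alpha> i * y ^ i) / \<gamma> - \<alpha> 1 * (y / \<gamma>)"
    using \<gamma> y by (simp add: deriv_divide[OF D] diff_divide_distrib)
  also have "(\<Sum>i=1..n. \<alpha> i * y ^ i) = \<alpha> 1 * y + (\<Sum>i=2..n. \<alpha> i * y ^ i)"
    using n by (simp add: sum.atLeast_Suc_atMost numeral_2_eq_2)
  also have "(\<alpha> 1 * y + (\<Sum>i=2..n. \<alpha> i * y ^ i)) / \<gamma> - \<alpha> 1 * (y / \<gamma>) =
      (\<Sum>i=2..n. \<alpha> i * y ^ i / \<gamma>)"
    by (simp add: add_divide_distrib sum_divide_distrib)
  also have "\<dots> = (\<Sum>i=2..n. \<alpha> i * \<gamma> ^ (i - 1) * (y / \<gamma>) ^ i)"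
  proof (rule sum.cong[OF refl])
    fix i assume "i \<in> {2..n}"
    then obtain j where "i = Suc j" by (cases i) auto
    then show "\<alpha> i * y ^ i / \<gamma> = \<alpha> i * \<gamma> ^ (i - 1) * (y / \<gamma>) ^ i"
      using \<gamma>(1) by (simp add: power_divide)
  qed
  finally show ?thesis by (simp add: poly_sum poly_monom)
qed

text \<open>
  The normalised trace commutes with \<open>D\<close> and fixes \<open>D x\<close>.
\<close>

lemma primitive_descends_to_base:
  fixes D :: "'a::field_char_0 \<Rightarrow> 'a"
  assumes D: "derivation D" and K: "differential_subfield D K"
    and x: "algebraic_over K x" "D x \<in> K"
  shows "\<exists>z\<in>K. D z = D x"
proof -
  note sN = subfield_adjoin[of K "{x}"]
  have KN: "D x \<in> adjoin K {x}" using x(2) subset_adjoin by blast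
  obtain \<tau> where "\<And>z. z \<in> adjoin K {x} \<Longrightarrow> \<tau> z \<in> K"
    and \<tau>: "\<And>c z. c \<in> K \<Longrightarrow> z \<in> adjoin K {x} \<Longrightarrow> \<tau> (c * z) = c * \<tau> z" "\<tau> 1 = 1"
    and "\<And>z. z \<in> adjoin K {x} \<Longrightarrow> \<tau> (D z) = D (\<tau> z)"
    using normalised_trace_exists[OF D K x(1) differential_subfield_adjoin[OF D K KN]] by metis
  then have "\<tau> x \<in> K" "D (\<tau> x) = \<tau> (D x)" using generator_in_adjoin[of x K] by auto
  moreover have "\<tau> (D x) = D x"
    using \<tau>(1)[OF x(2) subfield_1[OF sN]] \<tau>(2) by simp
  ultimately show ?thesis by auto
qed

theorem proposition3p3:
  fixes D :: "'a::field_char_0 \<Rightarrow> 'a"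
    and K Kbar E :: "'a set"
    and n :: nat
    and \<alpha> :: "nat \<Rightarrow> 'a"
    and F :: "'a \<Rightarrow> 'a \<Rightarrow> 'a"
    and y :: 'a
  assumes "derivation D"
    and "E = UNIV"
    and "differential_subfield D K"
    and "differential_subfield D Kbar"
    and "is_algebraic_closure K Kbar"
    and "liouvillian_extension D Kbar E"
    and "constants D E = constants D Kbar"
    and "n \<ge> 3"
    and "\<forall>i\<in>{1..n}. \<alpha> i \<in> K"
    and "\<And>Y Y'. F Y Y' = Y' - (\<Sum>i=1..n. \<alpha> i * Y ^ i)"
    and "y \<in> E" and "y \<notin> Kbar"
    and "F y (D y) = 0"
  shows "((\<exists>\<gamma>\<in>Kbar. \<gamma> \<noteq> 0 \<and> D \<gamma> = \<alpha> 1 * \<gamma>) \<longrightarrow>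
            \<not> (\<exists>z \<in> adjoin Kbar {y} - Kbar. D z / z \<in> Kbar)) \<and>
         (\<alpha> 1 = 0 \<and> (\<forall>x\<in>K. D x \<noteq> \<alpha> 2) \<longrightarrow>
            (\<exists>w \<in> adjoin Kbar {y} - Kbar. \<exists>v\<in>Kbar. D w = \<alpha> 2 \<and> D v = \<alpha> 3))"
proof -
  note D = assms(1) and K = assms(3) and L = assms(4)
  have sL: "subfield Kbar" using L by (simp add: differential_subfield_def)
  have const: "x \<in> Kbar" if "D x = 0" for x
  proof -
    have "x \<in> constants D E" using that assms(2) by (simp add: constants_def)
    then show ?thesis unfolding assms(7) by (simp add: constants_def)
  qed
  have \<alpha>: "\<alpha> i \<in> Kbar" if "i \<in> {1..n}" for i
    using assms(5,9) that by (auto simp: is_algebraic_closure_def)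
  have Dy: "D y = (\<Sum>i=1..n. \<alpha> i * y ^ i)" using assms(10,13) by simp
  define P where "P \<gamma> = (\<Sum>i=2..n. monom (\<alpha> i * \<gamma> ^ (i - 1)) i)" for \<gamma>
  have P: "P \<gamma> \<in> polys_over Kbar" if "\<gamma> \<in> Kbar" for \<gamma>
    unfolding P_def using that \<alpha>
    by (intro polys_over_sum polys_over_monom subfield_mult subfield_power sL) auto
  have coeffP: "coeff (P \<gamma>) i = (if i \<in> {2..n} then \<alpha> i * \<gamma> ^ (i - 1) else 0)" for \<gamma> i
    unfolding P_def by (auto simp: coeff_sum if_distrib cong: if_cong)
  have P01: "coeff (P \<gamma>) 0 = 0" "coeff (P \<gamma>) 1 = 0" for \<gamma> by (simp_all add: coeffP)
  have DP: "D (y / \<gamma>) = poly (P \<gamma>) (y / \<gamma>)" if "\<gamma> \<noteq> 0" "D \<gamma> = \<alpha> 1 * \<gamma>" for \<gamma>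
    unfolding P_def by (rule rescaled_equation[OF D Dy that]) (use assms(8) in simp)
  have trans: "\<not> algebraic_over Kbar u" if "u \<notin> Kbar" for u
    using that algebraic_over_algebraically_closed[OF assms(5)] by blast

  have "D z / z \<notin> Kbar"
    if \<gamma>: "\<gamma> \<in> Kbar" "\<gamma> \<noteq> 0" "D \<gamma> = \<alpha> 1 * \<gamma>" and z: "z \<in> adjoin Kbar {y}" "z \<notin> Kbar" for \<gamma> z
  proof
    assume a: "D z / z \<in> Kbar"
    define u where "u = y / \<gamma>"
    have y_eq: "y = \<gamma> * u" using \<gamma> by (simp add: u_def)
    have "u \<notin> Kbar" using assms(12) subfield_mult[OF sL \<gamma>(1)] y_eq by blast
    have "y \<in> adjoin Kbar {u}"
      unfolding y_eq using \<gamma>(1) subset_adjoin generator_in_adjoin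
      by (intro subfield_mult[OF subfield_adjoin]) auto
    then have "adjoin Kbar {y} \<subseteq> adjoin Kbar {u}"
      by (intro adjoin_least[OF subfield_adjoin subset_adjoin]) auto
    then have zu: "z \<in> adjoin Kbar {u}" using z(1) by blast
    have "z \<noteq> 0" using z(2) subfield_0[OF sL] by auto
    then have Dz: "D z = D z / z * z + 0" by simp
    obtain c where "D (z / c) = 0 / c" "z / c \<notin> Kbar"
      using linear_element_normal_form[OF D L const P[OF \<gamma>(1)] DP[OF \<gamma>(2,3), folded u_def]
          P01 trans[OF \<open>u \<notin> Kbar\<close>] zu z(2) Dz a subfield_0[OF sL]] by metis
    then show False using const by simp
  qed
  moreover have "\<exists>w \<in> adjoin Kbar {y} - Kbar. \<exists>v\<in>Kbar. D w = \<alpha> 2 \<and> D v = \<alpha> 3"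
    if \<alpha>1: "\<alpha> 1 = 0" and \<alpha>2: "\<forall>x\<in>K. D x \<noteq> \<alpha> 2"
  proof -
    have no_primitive: "D x \<noteq> \<alpha> 2" if "x \<in> Kbar" for x
    proof
      assume x: "D x = \<alpha> 2"
      have "algebraic_over K x" using that assms(5) by (simp add: is_algebraic_closure_def)
      moreover have "D x \<in> K" using x assms(8,9) by simp
      ultimately show False using primitive_descends_to_base[OF D K] \<alpha>2 x by metis
    qed
    have Py: "P 1 \<in> polys_over Kbar" "D y = poly (P 1) y"
      using P[OF subfield_1[OF sL]] DP[of 1] \<alpha>1 by (simp_all add: deriv_1[OF D])
    note y = trans[OF assms(12)]
    have "linear_element D Kbar y"
      using linear_element_exists[OF D _ const Py P01 y] assms(2,6) by simp
    then obtain g a b where g: "g \<in> adjoin Kbar {y}" "g \<notin> Kbar" "D g = a * g + b"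
      "a \<in> Kbar" "b \<in> Kbar"
      unfolding linear_element_def by blast
    obtain c f m where c: "c \<in> Kbar" "D (g / c) = b / c" "g / c \<in> adjoin Kbar {y}" "g / c \<notin> Kbar"
      and f: "expands Kbar y (g / c) f" and m: "m < 0" "f $$ m = 1" "\<And>j. j < m \<Longrightarrow> f $$ j = 0"
      using linear_element_normal_form[OF D L const Py P01 y g] by metis
    define h where "h = g / c"
    define d where "d = b / c"
    have Dh: "D (g / c) = 0 * (g / c) + d" and dL: "d \<in> Kbar"
      using c g(5) by (auto simp: d_def intro: subfield_divide[OF sL])
    have fL: "f $$ k \<in> Kbar" for k by (rule expands_coeff_in[OF sL f])
    have f_eq: "D (f $$ k) + (\<Sum>i=2..n. \<alpha> i * (of_int (k - int i + 1) * f $$ (k - int i + 1))) =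
        (if k = 0 then d else 0)" for k
    proof -
      have "degree (P 1) \<le> n" by (rule degree_le) (auto simp: coeffP)
      then have "(\<Sum>i\<le>degree (P 1). coeff (P 1) i * (of_int (k - int i + 1) * f $$ (k - int i + 1))) =
          (\<Sum>i\<le>n. coeff (P 1) i * (of_int (k - int i + 1) * f $$ (k - int i + 1)))"
        by (intro sum.mono_neutral_left) (auto simp: coeff_eq_0)
      also have "\<dots> = (\<Sum>i=2..n. \<alpha> i * (of_int (k - int i + 1) * f $$ (k - int i + 1)))"
        by (rule sum.mono_neutral_cong_right) (auto simp: coeffP)
      finally show ?thesis
        using expansion_coeff_equation[OF D L Py y f Dh subfield_0[OF sL] dL, of k] by simp
    qed
    have split: "(\<Sum>i=2..n. e i) = e 2 + e 3 + (\<Sum>i=4..n. e i)" for e :: "nat \<Rightarrow> 'a"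
      using assms(8) by (simp add: sum.atLeast_Suc_atMost[of _ n] eval_nat_numeral)
    \<comment> \<open>At the index \<open>m + 1\<close> only \<open>i = 2\<close> reaches a nonzero coefficient, the leading one.\<close>
    have "(\<Sum>i=2..n. \<alpha> i * (of_int (m + 1 - int i + 1) * f $$ (m + 1 - int i + 1))) = \<alpha> 2 * of_int m"
      unfolding split using m by simp
    with f_eq[of "m + 1"]
    have first: "D (f $$ (m + 1)) + \<alpha> 2 * of_int m = (if m + 1 = 0 then d else 0)" by simp
    have m1: "m = - 1"
    proof (rule ccontr)
      assume "m \<noteq> - 1"
      then have "D (f $$ (m + 1)) = - \<alpha> 2 * of_int m" using first by (simp add: add_eq_0_iff)
      moreover have "of_int m \<noteq> (0 :: 'a)" using m(1) by simp
      ultimately have "D (- f $$ (m + 1) / of_int m) = \<alpha> 2"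
        by (simp add: deriv_divide[OF D] deriv_of_int[OF D] deriv_uminus[OF D])
      then show False
        using no_primitive[of "- f $$ (m + 1) / of_int m"] fL
        by (auto intro: subfield_divide[OF sL] subfield_uminus[OF sL] subfield_of_int[OF sL])
    qed
    have "D (f $$ 0 - h) = \<alpha> 2"
      using first Dh by (simp add: m1 h_def deriv_diff[OF D] algebra_simps)
    moreover have "f $$ 0 - h \<in> adjoin Kbar {y} - Kbar"
    proof -
      have "f $$ 0 \<in> adjoin Kbar {y}" using fL subset_adjoin by blast
      moreover have "h = f $$ 0 - (f $$ 0 - h)" by simp
      ultimately show ?thesis
        using c(3,4) subfield_diff[OF subfield_adjoin] subfield_diff[OF sL fL] unfolding h_def
        by (metis DiffI)
    qed
    \<comment> \<open>At the index \<open>1\<close> the term for \<open>i = 2\<close> carries the factor \<open>0\<close>, and \<open>i = 3\<close> reaches the pole.\<close>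
    moreover have "(\<Sum>i=2..n. \<alpha> i * (of_int (1 - int i + 1) * f $$ (1 - int i + 1))) = - \<alpha> 3"
      unfolding split using m by (simp add: m1)
    then have "D (f $$ 1) = \<alpha> 3" using f_eq[of 1] by simp
    ultimately show ?thesis using fL by blast
  qed
  ultimately show ?thesis by blast
qed

end
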